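(* Let $S\subset K_1\times K_2$ be the set of solutions of the system of variational inequalities: $(f^*,x^*,q^*,d^*,h^* )\in K_1\times K_2$ belongs to $S$ if and only if, for all $(f,x,q,d)\in K_1$ and $h\in K_2$, $$\sum_{r\in O}\sum_{s\in D}\sum_{k\in R_{rs}}(f_k^{rs}-f_k^{rs*})\tfrac1\alpha\ln f_k^{rs*}+\sum_{a\in A}(x_a-x_a^* )\left[t_a(x_a^* )+x_a^*\tfrac{dt_a(x_a^* )}{dx_a}\right]+\sum_{r\in O}\sum_{s\in D}(q_{rs}-q_{rs}^* )\left(\tfrac1\gamma-\tfrac1\alpha\right)\ln q_{rs}^*-\sum_{s\in D}(d_s-d_s^* )\left[A_s(d_s^*,h_s^* )+d_s^*\tfrac{\partial A_s(d_s^*,h_s^* )}{\partial d_s}\right]\ge0$$ and $$\sum_{s\in D}(h_s-h_s^* )\left[\tfrac1\beta\ln h_s^*-B_s(d_s^*,h_s^* )\right]\ge0.$$ Let $$Z(f,x,q,d,h)=\tfrac1\alpha\sum_{r\in O}\sum_{s\in D}\sum_{k\in R_{rs}}f_k^{rs}(\ln f_k^{rs}-1)+\left(\tfrac1\gamma-\tfrac1\alpha\right)\sum_{r\in O}\sum_{s\in D}q_{rs}(\ln q_{rs}-1)+\sum_{a\in A}x_at_a(x_a)-\sum_{s\in D}A_s(d_s,h_s)d_s$$ be the total social cost of travelers. Then there exists an optimal road pricing scheme, in the following sense: $Z$ attains its minimum over $S$; and if $(f,x,q,d,h)\in S$ is any such minimizer and one imposes the constant tolls $$\tau_a=x_a\frac{dt_a(x_a)}{dx_a}\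 (a\in A),\qquad \pi_s=-d_s\frac{\partial A_s(d_s,h_s)}{\partial d_s}\ (s\in D)$$ on each traveler using link $a$, respectively entering business center $s$, then $(f,x,q,d,h)$ is a combined equilibrium of the tolled network, i.e. a combined equilibrium with respect to the link cost functions $t_a+\tau_a$, the trip attraction functions $A_s-\pi_s$ and the business attraction functions $B_s$.
   Context: $G=(V,A)$ is a finite directed network with link set $A$, finite nonempty origin set $O$ and destination set $D$ (every destination is a business center). For $r\in O$, $s\in D$, $R_{rs}$ is the (finite, nonempty) set of simple routes from $r$ to $s$; $\delta_{ak}^{rs}=1$ if link $a$ lies on route $k\in R_{rs}$ and $0$ otherwise. $O_r>0$ is the fixed travel demand from origin $r$, and $T>0$ is the fixed total number of business companies. Variables: path flows $f=(f_k^{rs})$, link flows $x=(x_a)$, origin-destination demands $q=(q_{rs})$, destination demands $d=(d_s)$, business flows $h=(h_s)$. $$K_1=\Big\{(f,x,q,d): f_k^{rs}\ge0,\ \sum_{k\in R_{rs}}f_k^{rs}=q_{rs},\ \sum_{s\in D}q_{rs}=O_r,\ \sum_{r\in O}\sum_{s\in D}\sum_{k\in R_{rs}}\delta_{ak}^{rs}f_k^{rs}=x_a,\ \sum_{r\in O}q_{rs}=d_s\ \ \forall k\in R_{rs},r\in O,s\in D,a\in A\Big\},$$ $$K_2=\Big\{h: h_s\ge0\ \forall s\in D,\ \sum_{s\in D}h_s=T\Big\}.$$ Parameters: $\alpha,\beta,\gamma>0$ with $\alpha\ge\gamma$. Standing assumptions on functions of nonnegative real arguments: each link travel time $t_a(x_a)$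 is convex, continuously differentiable and strictly increasing; each trip attraction function $A_s(d_s,h_s)$ is continuously differentiable, strictly decreasing and strictly concave in $d_s$, and strictly increasing in $h_s$; each business attraction function $B_s(d_s,h_s)$ is continuously differentiable, strictly increasing in $d_s$ and strictly decreasing in $h_s$. Definition: given link cost functions $\hat t_a$, trip attraction functions $\hat A_s$ and business attraction functions $\hat B_s$, a point $(f,x,q,d,h)\in K_1\times K_2$ is a (logit-based) combined equilibrium with respect to them if, for all $r\in O$, $s\in D$, $k\in R_{rs}$, $$q_{rs}=O_r\frac{\exp\{-\gamma[v_{rs}-\hat A_s(d_s,h_s)]\}}{\sum_{j\in D}\exp\{-\gamma[v_{rj}-\hat A_j(d_j,h_j)]\}},\quad f_k^{rs}=q_{rs}\frac{\exp\{-\alpha\sum_{a\in A}\delta_{ak}^{rs}\hat t_a(x_a)\}}{\sum_{j\in R_{rs}}\exp\{-\alpha\sum_{a\in A}\delta_{aj}^{rs}\hat t_a(x_a)\}},\quad h_s=T\frac{\exp[\beta\hat B_s(d_s,h_s)]}{\sum_{j\in D}\exp[\beta\hat B_j(d_j,h_j)]},$$ where $v_{rs}=-\frac1\alpha\ln\{\sum_{j\in R_{rs}}\exp[-\alpha\sum_{a\in A}\delta_{aj}^{rs}\hat t_a(x_a)]\}$. The system of variational inequalities defining $S$ describes travelers minimizing their total social cost given $h$, while companies locate at their competitive location equilibrium given $d$. Convention: since it contains logarithms evaluated at the candidate solution, a solution is understood to have all components $f_k^{rs*},q_{rs}^*,h_s^*>0$. *)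

theory Defs
  imports "HOL-Analysis.Analysis" "Graph_Theory.Arc_Walk"
begin

section \<open>Functions of nonnegative real arguments\<close>

text \<open>
  All model functions live on the closed half-line or the closed quadrant; only their values there
  are used.  Derivatives are taken within the domain, i.e. they are one-sided at boundary points.
\<close>

definition nn_deriv :: "(real \<Rightarrow> real) \<Rightarrow> real \<Rightarrow> real" where
  "nn_deriv g y = vector_derivative g (at y within {0..})"

definition nn_C1 :: "(real \<Rightarrow> real) \<Rightarrow> bool" where
  "nn_C1 g \<longleftrightarrow> (\<exists>g'. continuous_on {0..} g' \<and>
     (\<forall>y\<in>{0..}. (g has_real_derivative g' y) (at y within {0..})))"

definition nn_C1_2 :: "(real \<Rightarrow> real \<Rightarrow> real) \<Rightarrow> bool" where
  "nn_C1_2 F \<longleftrightarrow> (\<exists>F1 F2. continuous_on ({0..} \<times> {0..}) F1 \<and> continuous_on ({0..} \<times> {0..}) F2 \<and>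
     (\<forall>z\<in>{0..} \<times> {0..}.
        ((\<lambda>(y, h). F y h) has_derivative (\<lambda>(u, w). F1 z * u + F2 z * w))
          (at z within {0..} \<times> {0..})))"

definition strictly_concave_on :: "real set \<Rightarrow> (real \<Rightarrow> real) \<Rightarrow> bool" where
  "strictly_concave_on I g \<longleftrightarrow> convex I \<and>
     (\<forall>y\<in>I. \<forall>z\<in>I. y \<noteq> z \<longrightarrow>
        (\<forall>u. 0 < u \<and> u < 1 \<longrightarrow> g (u * y + (1 - u) * z) > u * g y + (1 - u) * g z))"

definition link_time_function :: "(real \<Rightarrow> real) \<Rightarrow> bool" where
  "link_time_function g \<longleftrightarrow> convex_on {0..} g \<and> nn_C1 g \<and> strict_mono_on {0..} g"

text \<open>Arguments of the attraction functions are the demand \<open>d\<^sub>s\<close>, then the business flow \<open>h\<^sub>s\<close>.\<close>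

definition trip_attraction_function :: "(real \<Rightarrow> real \<Rightarrow> real) \<Rightarrow> bool" where
  "trip_attraction_function F \<longleftrightarrow> nn_C1_2 F \<and>
     (\<forall>h\<ge>0. strict_antimono_on {0..} (\<lambda>y. F y h) \<and> strictly_concave_on {0..} (\<lambda>y. F y h)) \<and>
     (\<forall>y\<ge>0. strict_mono_on {0..} (\<lambda>h. F y h))"

definition business_attraction_function :: "(real \<Rightarrow> real \<Rightarrow> real) \<Rightarrow> bool" where
  "business_attraction_function F \<longleftrightarrow> nn_C1_2 F \<and>
     (\<forall>h\<ge>0. strict_mono_on {0..} (\<lambda>y. F y h)) \<and>
     (\<forall>y\<ge>0. strict_antimono_on {0..} (\<lambda>h. F y h))"


section \<open>Routes and feasible sets\<close>

text \<open>A route is the list of its links; vertices, hence links, are not repeated.\<close>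

definition routes :: "('v, 'l) pre_digraph \<Rightarrow> 'v \<Rightarrow> 'v \<Rightarrow> 'l list set" where
  "routes G r s = {k. pre_digraph.apath G r k s}"

definition incidence :: "'l \<Rightarrow> 'l list \<Rightarrow> real" where
  "incidence a k = (if a \<in> set k then 1 else 0)"

type_synonym ('v, 'l) traffic =
  "('v \<Rightarrow> 'v \<Rightarrow> 'l list \<Rightarrow> real) \<times> ('l \<Rightarrow> real) \<times> ('v \<Rightarrow> 'v \<Rightarrow> real) \<times> ('v \<Rightarrow> real)"

type_synonym ('v, 'l) state =
  "('v \<Rightarrow> 'v \<Rightarrow> 'l list \<Rightarrow> real) \<times> ('l \<Rightarrow> real) \<times> ('v \<Rightarrow> 'v \<Rightarrow> real) \<times> ('v \<Rightarrow> real) \<times> ('v \<Rightarrow> real)"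

text \<open>
  Finite families of variables are total functions.  Their values off the index sets are
  unconstrained and are never read.  The arguments \<open>Or\<close>, \<open>De\<close> and \<open>dem\<close> are the origin set,
  the destination set and the fixed origin demands.
\<close>

definition K1 :: "('v, 'l) pre_digraph \<Rightarrow> 'v set \<Rightarrow> 'v set \<Rightarrow> ('v \<Rightarrow> real) \<Rightarrow> ('v, 'l) traffic set" where
  "K1 G Or De dem = {(f, x, q, d).
     (\<forall>r\<in>Or. \<forall>s\<in>De. \<forall>k\<in>routes G r s. f r s k \<ge> 0) \<and>
     (\<forall>r\<in>Or. \<forall>s\<in>De. (\<Sum>k\<in>routes G r s. f r s k) = q r s) \<and>
     (\<forall>r\<in>Or. (\<Sum>s\<in>De. q r s) = dem r) \<and>
     (\<forall>a\<in>arcs G. (\<Sum>r\<in>Or. \<Sum>s\<in>De. \<Sum>k\<in>routes G r s. incidence a k * f r s k) = x a) \<and>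
     (\<forall>s\<in>De. (\<Sum>r\<in>Or. q r s) = d s)}"

definition K2 :: "'v set \<Rightarrow> real \<Rightarrow> ('v \<Rightarrow> real) set" where
  "K2 De T = {h. (\<forall>s\<in>De. h s \<ge> 0) \<and> (\<Sum>s\<in>De. h s) = T}"


section \<open>Combined equilibrium\<close>

definition route_cost ::
  "('v, 'l) pre_digraph \<Rightarrow> ('l \<Rightarrow> real \<Rightarrow> real) \<Rightarrow> ('l \<Rightarrow> real) \<Rightarrow> 'l list \<Rightarrow> real" where
  "route_cost G t x k = (\<Sum>a\<in>arcs G. incidence a k * t a (x a))"

definition expected_cost ::
  "('v, 'l) pre_digraph \<Rightarrow> real \<Rightarrow> ('l \<Rightarrow> real \<Rightarrow> real) \<Rightarrow> ('l \<Rightarrow> real) \<Rightarrow> 'v \<Rightarrow> 'v \<Rightarrow> real" where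
  "expected_cost G \<alpha> t x r s =
     - (1 / \<alpha>) * ln (\<Sum>j\<in>routes G r s. exp (- \<alpha> * route_cost G t x j))"

definition combined_equilibrium ::
  "('v, 'l) pre_digraph \<Rightarrow> 'v set \<Rightarrow> 'v set \<Rightarrow> ('v \<Rightarrow> real) \<Rightarrow> real \<Rightarrow> real \<Rightarrow> real \<Rightarrow> real \<Rightarrow>
   ('l \<Rightarrow> real \<Rightarrow> real) \<Rightarrow> ('v \<Rightarrow> real \<Rightarrow> real \<Rightarrow> real) \<Rightarrow> ('v \<Rightarrow> real \<Rightarrow> real \<Rightarrow> real) \<Rightarrow>
   ('v, 'l) state \<Rightarrow> bool" where
  "combined_equilibrium G Or De dem T \<alpha> \<beta> \<gamma> t A B = (\<lambda>(f, x, q, d, h).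
     (f, x, q, d) \<in> K1 G Or De dem \<and> h \<in> K2 De T \<and>
     (\<forall>r\<in>Or. \<forall>s\<in>De.
        q r s = dem r *
          (exp (- \<gamma> * (expected_cost G \<alpha> t x r s - A s (d s) (h s))) /
           (\<Sum>j\<in>De. exp (- \<gamma> * (expected_cost G \<alpha> t x r j - A j (d j) (h j)))))) \<and>
     (\<forall>r\<in>Or. \<forall>s\<in>De. \<forall>k\<in>routes G r s.
        f r s k = q r s *
          (exp (- \<alpha> * route_cost G t x k) /
           (\<Sum>j\<in>routes G r s. exp (- \<alpha> * route_cost G t x j)))) \<and>
     (\<forall>s\<in>De.
        h s = T * (exp (\<beta> * B s (d s) (h s)) / (\<Sum>j\<in>De. exp (\<beta> * B j (d j) (h j))))))"


section \<open>Variational inequalities and total social cost\<close>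

text \<open>
  The strict positivity of \<open>f\<close>, \<open>q\<close> and \<open>h\<close> makes the logarithms at the candidate solution
  meaningful (HOL's \<open>ln\<close> is total, with \<open>ln 0 = 0\<close>).
\<close>

definition VI_solutions ::
  "('v, 'l) pre_digraph \<Rightarrow> 'v set \<Rightarrow> 'v set \<Rightarrow> ('v \<Rightarrow> real) \<Rightarrow> real \<Rightarrow> real \<Rightarrow> real \<Rightarrow> real \<Rightarrow>
   ('l \<Rightarrow> real \<Rightarrow> real) \<Rightarrow> ('v \<Rightarrow> real \<Rightarrow> real \<Rightarrow> real) \<Rightarrow> ('v \<Rightarrow> real \<Rightarrow> real \<Rightarrow> real) \<Rightarrow>
   ('v, 'l) state set" where
  "VI_solutions G Or De dem T \<alpha> \<beta> \<gamma> t A B = {(f', x', q', d', h').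
     (f', x', q', d') \<in> K1 G Or De dem \<and> h' \<in> K2 De T \<and>
     (\<forall>r\<in>Or. \<forall>s\<in>De. \<forall>k\<in>routes G r s. f' r s k > 0) \<and>
     (\<forall>r\<in>Or. \<forall>s\<in>De. q' r s > 0) \<and>
     (\<forall>s\<in>De. h' s > 0) \<and>
     (\<forall>(f, x, q, d) \<in> K1 G Or De dem.
        (\<Sum>r\<in>Or. \<Sum>s\<in>De. \<Sum>k\<in>routes G r s. (f r s k - f' r s k) * ((1 / \<alpha>) * ln (f' r s k)))
        + (\<Sum>a\<in>arcs G. (x a - x' a) * (t a (x' a) + x' a * nn_deriv (t a) (x' a)))
        + (\<Sum>r\<in>Or. \<Sum>s\<in>De. (q r s - q' r s) * ((1 / \<gamma> - 1 / \<alpha>) * ln (q' r s)))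
        - (\<Sum>s\<in>De. (d s - d' s) *
             (A s (d' s) (h' s) + d' s * nn_deriv (\<lambda>y. A s y (h' s)) (d' s))) \<ge> 0) \<and>
     (\<forall>h \<in> K2 De T.
        (\<Sum>s\<in>De. (h s - h' s) * ((1 / \<beta>) * ln (h' s) - B s (d' s) (h' s))) \<ge> 0)}"

definition social_cost ::
  "('v, 'l) pre_digraph \<Rightarrow> 'v set \<Rightarrow> 'v set \<Rightarrow> real \<Rightarrow> real \<Rightarrow>
   ('l \<Rightarrow> real \<Rightarrow> real) \<Rightarrow> ('v \<Rightarrow> real \<Rightarrow> real \<Rightarrow> real) \<Rightarrow> ('v, 'l) state \<Rightarrow> real" where
  "social_cost G Or De \<alpha> \<gamma> t A = (\<lambda>(f, x, q, d, h).
     (1 / \<alpha>) * (\<Sum>r\<in>Or. \<Sum>s\<in>De. \<Sum>k\<in>routes G r s. f r s k * (ln (f r s k) - 1))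
     + (1 / \<gamma> - 1 / \<alpha>) * (\<Sum>r\<in>Or. \<Sum>s\<in>De. q r s * (ln (q r s) - 1))
     + (\<Sum>a\<in>arcs G. x a * t a (x a))
     - (\<Sum>s\<in>De. A s (d s) (h s) * d s))"

end

theory Submission
  imports Defs
begin

text \<open>
  The variational inequalities are the first-order conditions of a choice model in which travel
  times and trip attractions are replaced by their marginal counterparts:
  \<open>t a y + y * t' a y\<close> on links and \<open>A s y h + y * dA/dy\<close> at centers.  Because the candidate flows are positive, each inequality
  over a product of simplices (one per origin for routes and destinations, one for firms) forces
  its gradient to be constant on every simplex; solving this for the logarithms yields exactly the
  logit formulas.  Hence the solutions are precisely the combined equilibria for the marginal
  functions (\<open>VI_solutions_iff_equilibrium\<close>).  At a given state, the tolls \<open>\<tau>\<close> and \<open>\<pi>\<close> are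
  the differences between the marginal and the original functions, and the equilibrium
  conditions read these functions only at that state; so every solution, in particular every
  cost-minimal one, is an equilibrium of the tolled network.

  What remains is that the social cost attains its minimum.  An equilibrium is determined by its
  link flows, destination demands and business flows, through the logit formulas, which are
  continuous up to the boundary; so equilibria correspond to the fixed points of a continuous
  self-map of a cube.  The fixed points form a compact set, nonempty by Brouwer's theorem, on
  which the social cost is continuous (\<open>ex_cost_minimal_equilibrium\<close>).

  The dimension of that cube is the number of links plus twice the number of destinations, so
  Brouwer's theorem is needed for cubes indexed by an arbitrary finite set
  (\<open>brouwer_cube_finite\<close>).  It follows from Kuhn's combinatorial lemma and compactness.
\<close>


section \<open>Brouwer's theorem on cubes indexed by a finite set\<close>

text \<open>
  Coordinates outside \<open>I\<close> are pinned to \<open>0\<close>, so that the cube is compact in the product topology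
  of the full function type.
\<close>

definition cube :: "'i set \<Rightarrow> real \<Rightarrow> ('i \<Rightarrow> real) set" where
  "cube I M = {u. \<forall>i. u i \<in> (if i \<in> I then {0..M} else {0})}"

lemma cube_eq_PiE: "cube I M = Pi\<^sub>E UNIV (\<lambda>i. if i \<in> I then {0..M} else {0})"
  by (auto simp: cube_def PiE_def Pi_def)

lemma compact_cube: "compact (cube I M)"
proof -
  have "compactin (product_topology (\<lambda>_. euclidean) UNIV) (cube I M)"
    unfolding cube_eq_PiE by (subst compactin_PiE) (auto simp: compactin_euclidean_iff)
  then show ?thesis
    by (metis compactin_euclidean_iff euclidean_product_topology)
qed

lemma continuous_on_coordinate [continuous_intros]:
  "continuous_on S (\<lambda>u. u i :: 'b::topological_space)"
  by (rule continuous_on_subset[OF continuous_on_product_coordinates]) simp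

lemma closed_cube: "closed (cube I M)"
proof -
  have "cube I M = (\<Inter>i. {u. u i \<in> (if i \<in> I then {0..M} else {0})})"
    unfolding cube_def by blast
  moreover have "closed {u::'a \<Rightarrow> real. u i \<in> (if i \<in> I then {0..M} else {0})}" for i
    using closed_vimage[OF _ continuous_on_product_coordinates[of i], of "if i \<in> I then {0..M} else {0}"]
    by (auto simp: vimage_def)
  ultimately show ?thesis by (auto intro: closed_INT)
qed

lemma tendsto_fun_iff:
  fixes f :: "'a \<Rightarrow> 'i \<Rightarrow> 'b::topological_space"
  shows "(f \<longlongrightarrow> l) F \<longleftrightarrow> (\<forall>i. ((\<lambda>a. f a i) \<longlongrightarrow> l i) F)"
  using limitin_componentwise[of "\<lambda>_. euclidean" UNIV f l F]
  by (simp add: euclidean_product_topology)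

text \<open>
  On the grid of mesh \<open>M / (p + 1)\<close>, label a point in coordinate \<open>i\<close> by whether \<open>\<Phi>\<close> moves it up
  or down there.  Kuhn's lemma yields, for each \<open>p\<close>, a grid cell in which both labels occur in
  every coordinate.  The cells shrink to a point along a subsequence, and there \<open>\<Phi> u i \<ge> u i\<close>
  and \<open>\<Phi> u i \<le> u i\<close> by continuity.
\<close>

lemma brouwer_cube_nat:
  fixes \<Phi> :: "(nat \<Rightarrow> real) \<Rightarrow> nat \<Rightarrow> real"
  assumes M: "M > 0"
    and cont: "\<And>i. i < n \<Longrightarrow> continuous_on (cube {..<n} M) (\<lambda>u. \<Phi> u i)"
    and maps: "\<And>u i. u \<in> cube {..<n} M \<Longrightarrow> i < n \<Longrightarrow> \<Phi> u i \<in> {0..M}"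
  obtains u where "u \<in> cube {..<n} M" "\<And>i. i < n \<Longrightarrow> \<Phi> u i = u i"
proof -
  let ?C = "cube {..<n} M"
  define pt where "pt p x = (\<lambda>i. if i < n then M * real (x i) / real (Suc p) else 0)" for p and x :: "nat \<Rightarrow> nat"
  have pt_in: "pt p x \<in> ?C" if "\<forall>i<n. x i \<le> Suc p" for p x
    using that M by (auto simp: cube_def pt_def field_simps simp del: of_nat_Suc)
  \<comment> \<open>At the top face the label must be \<open>1\<close> even if \<open>\<Phi>\<close> fixes the coordinate, hence the first conjunct.\<close>
  define lab where
    "lab p x i = (if x i \<le> p \<and> \<Phi> (pt p x) i \<ge> pt p x i then 0 else 1::nat)" for p x i
  have "\<exists>q. (\<forall>i<n. q i \<le> p) \<and>
      (\<forall>i<n. \<exists>r s. (\<forall>j<n. q j \<le> r j \<and> r j \<le> q j + 1) \<and> (\<forall>j<n. q j \<le> s j \<and> s j \<le> q j + 1) \<and>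
        pt p r i \<le> \<Phi> (pt p r) i \<and> \<Phi> (pt p s) i \<le> pt p s i)" for p
  proof -
    have "0 < Suc p" by simp
    moreover have "\<forall>x. (\<forall>i<n. x i \<le> Suc p) \<longrightarrow> (\<forall>i<n. lab p x i = 0 \<or> lab p x i = 1)"
      by (auto simp: lab_def)
    moreover have "\<forall>x. (\<forall>i<n. x i \<le> Suc p) \<longrightarrow> (\<forall>i<n. x i = 0 \<longrightarrow> lab p x i = 0)"
    proof (intro allI impI)
      fix x i assume x: "\<forall>i<n. x i \<le> Suc p" "i < n" "x i = 0"
      then have "pt p x i = 0" by (simp add: pt_def)
      then show "lab p x i = 0" using maps[OF pt_in[OF x(1)] x(2)] x(3) by (simp add: lab_def)
    qed
    moreover have "\<forall>x. (\<forall>i<n. x i \<le> Suc p) \<longrightarrow> (\<forall>i<n. x i = Suc p \<longrightarrow> lab p x i = 1)"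
      by (auto simp: lab_def)
    ultimately obtain q where q: "\<forall>i<n. q i < Suc p"
      and rs: "\<forall>i<n. \<exists>r s. (\<forall>j<n. q j \<le> r j \<and> r j \<le> q j + 1) \<and>
        (\<forall>j<n. q j \<le> s j \<and> s j \<le> q j + 1) \<and> lab p r i \<noteq> lab p s i"
      by (rule kuhn_lemma)
    have up: "pt p r i \<le> \<Phi> (pt p r) i" if "lab p r i = 0" for r i
      using that by (auto simp: lab_def split: if_splits)
    have down: "\<Phi> (pt p r) i \<le> pt p r i"
      if "lab p r i \<noteq> 0" "\<forall>j<n. q j \<le> r j \<and> r j \<le> q j + 1" "i < n" for r i
    proof -
      have r: "\<forall>j<n. r j \<le> Suc p" using that q by fastforce
      show ?thesis
      proof (cases "r i \<le> p")
        case True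
        then show ?thesis using that by (auto simp: lab_def split: if_splits)
      next
        case False
        then have "r i = Suc p" using r that by (simp add: le_antisym not_less_eq_eq)
        then have "pt p r i = M" using that by (simp add: pt_def del: of_nat_Suc)
        then show ?thesis using maps[OF pt_in[OF r] that(3)] by simp
      qed
    qed
    have "\<exists>r s. (\<forall>j<n. q j \<le> r j \<and> r j \<le> q j + 1) \<and> (\<forall>j<n. q j \<le> s j \<and> s j \<le> q j + 1) \<and>
        pt p r i \<le> \<Phi> (pt p r) i \<and> \<Phi> (pt p s) i \<le> pt p s i" if "i < n" for i
    proof -
      obtain r s where r: "\<forall>j<n. q j \<le> r j \<and> r j \<le> q j + 1"
        and s: "\<forall>j<n. q j \<le> s j \<and> s j \<le> q j + 1" and ne: "lab p r i \<noteq> lab p s i"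
        using rs \<open>i < n\<close> by blast
      show ?thesis
      proof (cases "lab p r i = 0")
        case True
        then show ?thesis using up[of r i] down[of s i] r s ne that by metis
      next
        case False
        then have "lab p s i = 0" using ne by (auto simp: lab_def split: if_splits)
        then show ?thesis using up[of s i] down[of r i] r s False that by metis
      qed
    qed
    then show ?thesis using q less_Suc_eq_le by blast
  qed
  then obtain q where q: "\<And>p i. i < n \<Longrightarrow> q p i \<le> p"
    and rs: "\<And>p i. i < n \<Longrightarrow> \<exists>r s. (\<forall>j<n. q p j \<le> r j \<and> r j \<le> q p j + 1) \<and>
        (\<forall>j<n. q p j \<le> s j \<and> s j \<le> q p j + 1) \<and>
        pt p r i \<le> \<Phi> (pt p r) i \<and> \<Phi> (pt p s) i \<le> pt p s i"
    by metis
  define bracket where "bracket p i r s \<longleftrightarrow>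
      (\<forall>j<n. q p j \<le> r j \<and> r j \<le> q p j + 1) \<and> (\<forall>j<n. q p j \<le> s j \<and> s j \<le> q p j + 1) \<and>
      pt p r i \<le> \<Phi> (pt p r) i \<and> \<Phi> (pt p s) i \<le> pt p s i" for p i r s
  have "\<forall>p i. \<exists>r s. i < n \<longrightarrow> bracket p i r s"
    using rs unfolding bracket_def by blast
  then obtain r s where "\<And>p i. i < n \<Longrightarrow> bracket p i (r p i) (s p i)"
    by metis
  then have r: "\<And>p i j. i < n \<Longrightarrow> j < n \<Longrightarrow> q p j \<le> r p i j \<and> r p i j \<le> q p j + 1"
    and s: "\<And>p i j. i < n \<Longrightarrow> j < n \<Longrightarrow> q p j \<le> s p i j \<and> s p i j \<le> q p j + 1"
    and r_up: "\<And>p i. i < n \<Longrightarrow> pt p (r p i) i \<le> \<Phi> (pt p (r p i)) i"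
    and s_down: "\<And>p i. i < n \<Longrightarrow> \<Phi> (pt p (s p i)) i \<le> pt p (s p i) i"
    unfolding bracket_def by auto
  have "pt p (q p) \<in> ?C" for p using q by (intro pt_in) (auto intro: le_SucI)
  then obtain u \<rho> where u: "u \<in> ?C" and \<rho>: "strict_mono \<rho>"
    and lim: "((\<lambda>p. pt p (q p)) \<circ> \<rho>) \<longlonglongrightarrow> u"
    using seq_compactE[OF compact_imp_seq_compact[OF compact_cube]] by metis
  \<comment> \<open>Any choice of corners of the selected cells has the same limit, since the mesh tends to zero.\<close>
  have corner: "(\<lambda>p. pt (\<rho> p) (c (\<rho> p))) \<longlonglongrightarrow> u"
    if c: "\<And>p j. j < n \<Longrightarrow> q p j \<le> c p j \<and> c p j \<le> q p j + 1" for c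
    unfolding tendsto_fun_iff
  proof
    fix j
    have "(\<lambda>p. M / real (Suc (\<rho> p))) \<longlonglongrightarrow> 0"
      using LIMSEQ_subseq_LIMSEQ[OF tendsto_mult_right_zero[OF LIMSEQ_inverse_real_of_nat, of M] \<rho>]
      by (simp add: o_def divide_inverse)
    moreover have "norm (pt (\<rho> p) (c (\<rho> p)) j - pt (\<rho> p) (q (\<rho> p)) j) \<le> M / real (Suc (\<rho> p))" for p
    proof (cases "j < n")
      case True
      have "pt (\<rho> p) (c (\<rho> p)) j - pt (\<rho> p) (q (\<rho> p)) j
          = (M / real (Suc (\<rho> p))) * (real (c (\<rho> p) j) - real (q (\<rho> p) j))"
        using True by (simp add: pt_def field_simps del: of_nat_Suc)
      also have "norm \<dots> \<le> (M / real (Suc (\<rho> p))) * 1"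
        unfolding norm_mult using c[OF True, of "\<rho> p"] M
        by (intro mult_mono) auto
      finally show ?thesis by simp
    qed (use M in \<open>simp add: pt_def\<close>)
    ultimately have "(\<lambda>p. pt (\<rho> p) (c (\<rho> p)) j - pt (\<rho> p) (q (\<rho> p)) j) \<longlonglongrightarrow> 0"
      by (rule Lim_null_comparison[OF always_eventually[OF allI], rotated])
    moreover have "(\<lambda>p. pt (\<rho> p) (q (\<rho> p)) j) \<longlonglongrightarrow> u j"
      using lim unfolding tendsto_fun_iff o_def by blast
    ultimately show "(\<lambda>p. pt (\<rho> p) (c (\<rho> p)) j) \<longlonglongrightarrow> u j"
      using tendsto_add by fastforce
  qed
  have limits: "(\<lambda>p. \<Phi> (pt (\<rho> p) (c (\<rho> p))) i) \<longlonglongrightarrow> \<Phi> u i"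
      "(\<lambda>p. pt (\<rho> p) (c (\<rho> p)) i) \<longlonglongrightarrow> u i"
    if c: "\<And>p j. j < n \<Longrightarrow> q p j \<le> c p j \<and> c p j \<le> q p j + 1" and "i < n" for c i
  proof -
    have "pt (\<rho> p) (c (\<rho> p)) \<in> ?C" for p
    proof (rule pt_in, intro allI impI)
      fix j assume "j < n"
      then show "c (\<rho> p) j \<le> Suc (\<rho> p)" using c[of j "\<rho> p"] q[of j "\<rho> p"] by linarith
    qed
    then show "(\<lambda>p. \<Phi> (pt (\<rho> p) (c (\<rho> p))) i) \<longlonglongrightarrow> \<Phi> u i"
      using continuous_on_tendsto_compose[OF cont[OF \<open>i < n\<close>] corner[OF c] u] by simp
    show "(\<lambda>p. pt (\<rho> p) (c (\<rho> p)) i) \<longlonglongrightarrow> u i"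
      using corner[OF c] unfolding tendsto_fun_iff by blast
  qed
  have "\<Phi> u i = u i" if "i < n" for i
  proof (rule antisym)
    show "\<Phi> u i \<le> u i"
      using limits[of "\<lambda>p. s p i" i] s s_down that by (meson LIMSEQ_le)
    show "u i \<le> \<Phi> u i"
      using limits[of "\<lambda>p. r p i" i] r r_up that by (meson LIMSEQ_le)
  qed
  with u show ?thesis by (rule that)
qed

text \<open>
  Transport of the previous lemma along an enumeration of \<open>I\<close>.
\<close>

lemma brouwer_cube_finite:
  fixes \<Phi> :: "('i \<Rightarrow> real) \<Rightarrow> 'i \<Rightarrow> real"
  assumes I: "finite I" and M: "M > 0"
    and cont: "\<And>i. i \<in> I \<Longrightarrow> continuous_on (cube I M) (\<lambda>u. \<Phi> u i)"
    and maps: "\<And>u i. u \<in> cube I M \<Longrightarrow> i \<in> I \<Longrightarrow> \<Phi> u i \<in> {0..M}"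
  obtains u where "u \<in> cube I M" "\<And>i. i \<in> I \<Longrightarrow> \<Phi> u i = u i"
proof -
  let ?n = "card I"
  obtain e where e: "bij_betw e {..<?n} I"
    using ex_bij_betw_nat_finite[OF I] by (auto simp: atLeast0LessThan)
  define e' where "e' = the_inv_into {..<?n} e"
  have e': "e' i < ?n" "e (e' i) = i" if "i \<in> I" for i
    using that e bij_betw_the_inv_into[OF e] f_the_inv_into_f_bij_betw[OF e]
    by (auto simp: e'_def dest: bij_betwE)
  have e_in: "e j \<in> I" and e'e: "e' (e j) = j" if "j < ?n" for j
    using that e by (auto simp: e'_def dest: bij_betwE intro: the_inv_into_f_f bij_betw_imp_inj_on)
  define ext where "ext v = (\<lambda>i. if i \<in> I then v (e' i) else 0)" for v :: "nat \<Rightarrow> real"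
  have ext_in: "ext v \<in> cube I M" if "v \<in> cube {..<?n} M" for v
    using that e'(1) unfolding cube_def ext_def by (auto split: if_splits)
  have ext_cont: "continuous_on S ext" for S
    unfolding ext_def
  proof (rule continuous_on_coordinatewise_then_product)
    show "continuous_on S (\<lambda>v. if i \<in> I then v (e' i) else 0 :: real)" for i
      by (cases "i \<in> I") (auto intro!: continuous_intros)
  qed
  obtain v where v: "v \<in> cube {..<?n} M" "\<And>j. j < ?n \<Longrightarrow> \<Phi> (ext v) (e j) = v j"
  proof (rule brouwer_cube_nat[OF M, of ?n "\<lambda>v j. \<Phi> (ext v) (e j)"])
    fix j assume "j < ?n"
    then show "continuous_on (cube {..<?n} M) (\<lambda>v. \<Phi> (ext v) (e j))"
      by (intro continuous_on_compose2[OF cont ext_cont]) (auto simp: e_in intro: ext_in)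
  qed (use maps ext_in e_in in auto)
  show ?thesis
  proof (rule that)
    show "ext v \<in> cube I M" using ext_in v by blast
    show "\<Phi> (ext v) i = ext v i" if "i \<in> I" for i
      using v(2)[OF e'(1)[OF that]] e'(2)[OF that] that by (simp add: ext_def[of v] cong: if_cong)
  qed
qed


section \<open>Logit shares\<close>

text \<open>
  The multinomial logit share of alternative \<open>i\<close> with utilities \<open>c\<close>.
\<close>

definition logit :: "'i set \<Rightarrow> ('i \<Rightarrow> real) \<Rightarrow> 'i \<Rightarrow> real" where
  "logit I c i = exp (c i) / (\<Sum>j\<in>I. exp (c j))"

lemma sum_exp_pos:
  fixes c :: "'i \<Rightarrow> real"
  assumes "finite I" "I \<noteq> {}"
  shows "(\<Sum>j\<in>I. exp (c j)) > 0"
  using assms by (intro sum_pos) auto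

lemma logit_pos: "finite I \<Longrightarrow> I \<noteq> {} \<Longrightarrow> logit I c i > 0"
  unfolding logit_def by (simp add: sum_exp_pos)

lemma sum_logit: "finite I \<Longrightarrow> I \<noteq> {} \<Longrightarrow> (\<Sum>i\<in>I. logit I c i) = 1"
  using sum_exp_pos[of I c] by (simp add: logit_def flip: sum_divide_distrib)

lemma logit_cong: "(\<And>j. j \<in> I \<Longrightarrow> c j = c' j) \<Longrightarrow> i \<in> I \<Longrightarrow> logit I c i = logit I c' i"
  by (simp add: logit_def)

lemma ln_logit:
  assumes "finite I" "I \<noteq> {}" "W > 0"
  shows "ln (W * logit I c i) = ln W + c i - ln (\<Sum>j\<in>I. exp (c j))"
  using assms sum_exp_pos[of I c] by (simp add: logit_def ln_mult ln_div)

text \<open>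
  Logit shares are the positive solutions of the entropic first-order condition; the constant
  \<open>l\<close> is the multiplier of the budget constraint and is eliminated by normalisation.
\<close>

lemma eq_logit_iff:
  assumes I: "finite I" "I \<noteq> {}" and w: "\<And>i. i \<in> I \<Longrightarrow> w i > 0" and W: "(\<Sum>i\<in>I. w i) = W"
  shows "(\<forall>i\<in>I. w i = W * logit I c i) \<longleftrightarrow> (\<exists>l. \<forall>i\<in>I. ln (w i) - c i = l)"
proof
  have "W > 0" unfolding W[symmetric] using I w by (intro sum_pos) auto
  then show "\<exists>l. \<forall>i\<in>I. ln (w i) - c i = l" if "\<forall>i\<in>I. w i = W * logit I c i"
    using that I by (simp add: ln_logit)
next
  assume "\<exists>l. \<forall>i\<in>I. ln (w i) - c i = l"
  then obtain l where "\<forall>i\<in>I. ln (w i) = l + c i" by (auto simp: algebra_simps)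
  then have w_eq: "w i = exp l * exp (c i)" if "i \<in> I" for i
    using w that by (metis exp_add exp_ln)
  then have "W = exp l * (\<Sum>j\<in>I. exp (c j))"
    by (simp add: sum_distrib_left flip: W)
  then show "\<forall>i\<in>I. w i = W * logit I c i"
    using w_eq sum_exp_pos[OF I, of c] by (simp add: logit_def)
qed

lemma continuous_on_logit:
  assumes "finite I" "I \<noteq> {}" "\<And>j. j \<in> I \<Longrightarrow> continuous_on S (\<lambda>u. c u j)" "i \<in> I"
  shows "continuous_on S (\<lambda>u. logit I (c u) i)"
  unfolding logit_def using assms
  by (intro continuous_intros) (auto simp: sum_exp_pos less_imp_neq[symmetric])

text \<open>
  The stationarity condition of the two-level model: \<open>S\<close> are the destinations, \<open>K s\<close> the routes,
  \<open>w\<close> route flows and \<open>u\<close> demands.  For fixed \<open>s\<close> the condition says that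
  \<open>ln (w s k) + \<alpha> * C s k\<close> does not depend on \<open>k\<close>, which is the inner logit.  Substituting
  this back replaces the route cost by the log-sum \<open>v s\<close> and merges the two entropy
  weights \<open>1 / \<alpha>\<close> and \<open>1 / \<gamma> - 1 / \<alpha>\<close> into \<open>1 / \<gamma>\<close>, which gives the outer logit.
\<close>

lemma nested_logit_iff:
  fixes w C :: "'s \<Rightarrow> 'k \<Rightarrow> real" and u m :: "'s \<Rightarrow> real"
  assumes S: "finite S" "S \<noteq> {}" and K: "\<And>s. s \<in> S \<Longrightarrow> finite (K s)" "\<And>s. s \<in> S \<Longrightarrow> K s \<noteq> {}"
    and pos: "\<And>s k. s \<in> S \<Longrightarrow> k \<in> K s \<Longrightarrow> w s k > 0" "\<And>s. s \<in> S \<Longrightarrow> u s > 0"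
    and sums: "\<And>s. s \<in> S \<Longrightarrow> (\<Sum>k\<in>K s. w s k) = u s" "(\<Sum>s\<in>S. u s) = W"
    and \<alpha>: "\<alpha> > 0" and \<gamma>: "\<gamma> > 0"
  defines "v \<equiv> \<lambda>s. - (1 / \<alpha>) * ln (\<Sum>k\<in>K s. exp (- \<alpha> * C s k))"
  shows "(\<exists>l. \<forall>s\<in>S. \<forall>k\<in>K s.
            (1 / \<alpha>) * ln (w s k) + C s k + (1 / \<gamma> - 1 / \<alpha>) * ln (u s) - m s = l) \<longleftrightarrow>
         (\<forall>s\<in>S. u s = W * logit S (\<lambda>s. - \<gamma> * (v s - m s)) s) \<and>
         (\<forall>s\<in>S. \<forall>k\<in>K s. w s k = u s * logit (K s) (\<lambda>k. - \<alpha> * C s k) k)"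
    (is "(\<exists>l. \<forall>s\<in>S. \<forall>k\<in>K s. ?c s k = l) \<longleftrightarrow> ?outer \<and> ?inner")
proof -
  have inner: "(\<forall>k\<in>K s. w s k = u s * logit (K s) (\<lambda>k. - \<alpha> * C s k) k) \<longleftrightarrow>
      (\<exists>l. \<forall>k\<in>K s. ln (w s k) - (- \<alpha> * C s k) = l)" if "s \<in> S" for s
    using that by (intro eq_logit_iff) (auto simp: K pos sums)
  have outer: "?outer \<longleftrightarrow> (\<exists>l. \<forall>s\<in>S. ln (u s) - (- \<gamma> * (v s - m s)) = l)"
    by (intro eq_logit_iff) (auto simp: S pos sums)
  have key: "?c s k = (1 / \<gamma>) * (ln (u s) - (- \<gamma> * (v s - m s)))"
    if "s \<in> S" "k \<in> K s" "w s k = u s * logit (K s) (\<lambda>k. - \<alpha> * C s k) k" for s k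
  proof -
    have "ln (w s k) = ln (u s) + (- \<alpha> * C s k) + \<alpha> * v s"
      unfolding that(3) using that(1) \<alpha> by (simp add: ln_logit K pos v_def)
    then show ?thesis using \<alpha> \<gamma> by (simp add: field_simps)
  qed
  show ?thesis
  proof
    assume "\<exists>l. \<forall>s\<in>S. \<forall>k\<in>K s. ?c s k = l"
    then obtain l where l: "\<And>s k. s \<in> S \<Longrightarrow> k \<in> K s \<Longrightarrow> ?c s k = l" by blast
    have ?inner
    proof
      fix s assume s: "s \<in> S"
      have "ln (w s k) - (- \<alpha> * C s k) = \<alpha> * (l + m s - (1 / \<gamma> - 1 / \<alpha>) * ln (u s))"
        if "k \<in> K s" for k
        unfolding l[OF s that, symmetric] using \<alpha> by (simp add: algebra_simps)
      then show "\<forall>k\<in>K s. w s k = u s * logit (K s) (\<lambda>k. - \<alpha> * C s k) k"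
        unfolding inner[OF s] by blast
    qed
    moreover have "ln (u s) - (- \<gamma> * (v s - m s)) = \<gamma> * l" if s: "s \<in> S" for s
    proof -
      obtain k where k: "k \<in> K s" using K(2)[OF s] by blast
      have "(1 / \<gamma>) * (ln (u s) - (- \<gamma> * (v s - m s))) = l"
        using key[OF s k] l[OF s k] \<open>?inner\<close> s k by simp
      then show ?thesis using \<gamma> by (simp add: field_simps)
    qed
    ultimately show "?outer \<and> ?inner" unfolding outer by blast
  next
    assume *: "?outer \<and> ?inner"
    then obtain l where "\<And>s. s \<in> S \<Longrightarrow> ln (u s) - (- \<gamma> * (v s - m s)) = l"
      unfolding outer by blast
    then have "\<forall>s\<in>S. \<forall>k\<in>K s. ?c s k = (1 / \<gamma>) * l"
      using key * by simp
    then show "\<exists>l. \<forall>s\<in>S. \<forall>k\<in>K s. ?c s k = l" by blast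
  qed
qed


section \<open>Variational inequalities on a simplex\<close>

text \<open>
  At an interior point, all the mass of \<open>i\<close> may be moved to \<open>j\<close>; the inequality then says that
  \<open>j\<close> is at least as costly as \<open>i\<close>, and the roles of \<open>i\<close> and \<open>j\<close> can be exchanged.
\<close>

lemma simplex_stationary:
  fixes c w :: "'i \<Rightarrow> real"
  assumes I: "finite I" and w: "\<And>i. i \<in> I \<Longrightarrow> w i > 0"
    and VI: "\<And>v. (\<And>i. i \<in> I \<Longrightarrow> v i \<ge> 0) \<Longrightarrow> (\<Sum>i\<in>I. v i) = (\<Sum>i\<in>I. w i)
      \<Longrightarrow> (\<Sum>i\<in>I. (v i - w i) * c i) \<ge> 0"
  shows "\<exists>l. \<forall>i\<in>I. c i = l"
proof -
  have le: "c i \<le> c j" if "i \<in> I" "j \<in> I" for i j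
  proof (cases "i = j")
    case False
    define v where "v = w(i := 0, j := w j + w i)"
    have diff: "v k - w k = (if k = j then w i else 0) - (if k = i then w i else 0)" for k
      using False by (simp add: v_def)
    have "(\<Sum>k\<in>I. v k - w k) = 0"
      unfolding diff using I that by (simp add: sum_subtractf)
    moreover have "v k \<ge> 0" if "k \<in> I" for k
      using w[OF that] w[OF \<open>i \<in> I\<close>] w[OF \<open>j \<in> I\<close>] by (auto simp: v_def)
    ultimately have "0 \<le> (\<Sum>k\<in>I. (v k - w k) * c k)"
      by (intro VI) (auto simp: sum_subtractf)
    also have "\<dots> = (\<Sum>k\<in>I. (if k = j then w i * c j else 0) - (if k = i then w i * c i else 0))"
      unfolding diff by (intro sum.cong) (auto simp: algebra_simps)
    also have "\<dots> = w i * (c j - c i)"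
      using I that by (simp add: sum_subtractf algebra_simps)
    finally show ?thesis
      using w[OF \<open>i \<in> I\<close>] by (simp add: zero_le_mult_iff)
  qed simp
  show ?thesis
  proof (cases "I = {}")
    case False
    then show ?thesis using le by (meson antisym ex_in_conv)
  qed simp
qed


section \<open>Continuity of one-sided derivatives\<close>

lemma at_within_nonneg_neq_bot: "at y within {0..} \<noteq> bot" if "y \<ge> 0" for y :: real
proof -
  have "\<nexists>a. {0::real..} = {a}"
    by (metis atLeast_iff order.refl singleton_iff zero_le_one zero_neq_one)
  then have "y islimpt {0..}"
    using that by (intro connected_imp_perfect) auto
  then show ?thesis by (simp add: trivial_limit_within)
qed

lemma nn_deriv_eq:
  assumes "(g has_real_derivative D) (at y within {0..})" "y \<ge> 0"
  shows "nn_deriv g y = D"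
  unfolding nn_deriv_def using assms
  by (intro vector_derivative_within at_within_nonneg_neq_bot)
     (auto simp: has_real_derivative_iff_has_vector_derivative)

lemma nn_C1_continuous:
  assumes "nn_C1 g"
  shows "continuous_on {0..} g" "continuous_on {0..} (nn_deriv g)"
proof -
  obtain g' where g': "continuous_on {0..} g'"
    "\<And>y. y \<ge> 0 \<Longrightarrow> (g has_real_derivative g' y) (at y within {0..})"
    using assms by (auto simp: nn_C1_def)
  show "continuous_on {0..} g"
    using g'(2) by (intro DERIV_continuous_on) auto
  show "continuous_on {0..} (nn_deriv g)"
    using g'(1) by (rule continuous_on_eq) (simp add: nn_deriv_eq[OF g'(2)])
qed

lemma nn_C1_2_continuous:
  assumes "nn_C1_2 F"
  shows "continuous_on ({0..} \<times> {0..}) (\<lambda>(y, h). F y h)"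
    "continuous_on ({0..} \<times> {0..}) (\<lambda>(y, h). nn_deriv (\<lambda>y. F y h) y)"
proof -
  obtain F1 F2 where F1: "continuous_on ({0..} \<times> {0..}) F1"
    and F: "\<And>z. z \<in> {0..} \<times> {0..} \<Longrightarrow>
        ((\<lambda>(y, h). F y h) has_derivative (\<lambda>(u, w). F1 z * u + F2 z * w))
          (at z within {0..} \<times> {0..})"
    using assms unfolding nn_C1_2_def by blast
  show "continuous_on ({0..} \<times> {0..}) (\<lambda>(y, h). F y h)"
    using F by (rule has_derivative_continuous_on)
  have "nn_deriv (\<lambda>y. F y h) y = F1 (y, h)" if "y \<ge> 0" "h \<ge> 0" for y h
  proof (rule nn_deriv_eq)
    have pair: "((\<lambda>y. (y, h)) has_derivative (\<lambda>u. (u, 0))) (at y within {0..})"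
      by (auto intro!: derivative_eq_intros)
    have "((\<lambda>(y, h). F y h) has_derivative (\<lambda>(u, w). F1 (y, h) * u + F2 (y, h) * w))
          (at (y, h) within (\<lambda>y. (y, h)) ` {0..})"
      using that by (intro has_derivative_subset[OF F]) auto
    from has_derivative_in_compose[OF pair this]
    show "((\<lambda>y. F y h) has_real_derivative F1 (y, h)) (at y within {0..})"
      by (simp add: has_field_derivative_def)
  qed (use that in auto)
  then show "continuous_on ({0..} \<times> {0..}) (\<lambda>(y, h). nn_deriv (\<lambda>y. F y h) y)"
    by (intro continuous_on_eq[OF F1]) auto
qed


section \<open>Logit flows and combined equilibria\<close>

lemma sum_swap_inward:
  "(\<Sum>a\<in>A. \<Sum>r\<in>R. \<Sum>s\<in>S. \<Sum>k\<in>K r s. X a r s k) =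
   (\<Sum>r\<in>R. \<Sum>s\<in>S. \<Sum>k\<in>K r s. \<Sum>a\<in>A. X a r s k)"
proof -
  have "(\<Sum>a\<in>A. \<Sum>s\<in>S. \<Sum>k\<in>K r s. X a r s k) = (\<Sum>s\<in>S. \<Sum>k\<in>K r s. \<Sum>a\<in>A. X a r s k)" for r
    by (subst sum.swap, intro sum.cong refl sum.swap)
  then show ?thesis
    by (subst sum.swap) simp
qed

text \<open>
  The derivatives of \<open>y * t a y\<close> and of \<open>y * A s y h\<close> with respect to \<open>y\<close>, i.e. the change
  in the total of all travelers caused by one more of them.
\<close>

definition marginal_time :: "('l \<Rightarrow> real \<Rightarrow> real) \<Rightarrow> 'l \<Rightarrow> real \<Rightarrow> real" where
  "marginal_time t a y = t a y + y * nn_deriv (t a) y"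

definition marginal_attraction :: "('v \<Rightarrow> real \<Rightarrow> real \<Rightarrow> real) \<Rightarrow> 'v \<Rightarrow> real \<Rightarrow> real \<Rightarrow> real" where
  "marginal_attraction A s y h = A s y h + y * nn_deriv (\<lambda>y. A s y h) y"

text \<open>
  On the feasible set, link flows and demands are linear in the route flows, so that the left side
  of the first variational inequality collapses to a pairing of route-flow differences with one
  generalised route cost.
\<close>

lemma K1_pairing:
  assumes p: "(f, x, q, d) \<in> K1 G Or De dem" and p': "(f', x', q', d') \<in> K1 G Or De dem"
  shows "(\<Sum>r\<in>Or. \<Sum>s\<in>De. \<Sum>k\<in>routes G r s. (f r s k - f' r s k) * l r s k)
        + (\<Sum>a\<in>arcs G. (x a - x' a) * c a)
        + (\<Sum>r\<in>Or. \<Sum>s\<in>De. (q r s - q' r s) * g r s)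
        - (\<Sum>s\<in>De. (d s - d' s) * m s)
      = (\<Sum>r\<in>Or. \<Sum>s\<in>De. \<Sum>k\<in>routes G r s. (f r s k - f' r s k) *
          (l r s k + (\<Sum>a\<in>arcs G. incidence a k * c a) + g r s - m s))"
proof -
  have q: "q r s - q' r s = (\<Sum>k\<in>routes G r s. f r s k - f' r s k)" if "r \<in> Or" "s \<in> De" for r s
    using p p' that by (simp add: K1_def sum_subtractf)
  have x: "x a - x' a = (\<Sum>r\<in>Or. \<Sum>s\<in>De. \<Sum>k\<in>routes G r s. incidence a k * (f r s k - f' r s k))"
    if "a \<in> arcs G" for a
    using p p' that by (simp add: K1_def sum_subtractf right_diff_distrib)
  have d: "d s - d' s = (\<Sum>r\<in>Or. q r s - q' r s)" if "s \<in> De" for s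
    using p p' that by (simp add: K1_def sum_subtractf)
  have "(\<Sum>a\<in>arcs G. (x a - x' a) * c a) =
      (\<Sum>a\<in>arcs G. \<Sum>r\<in>Or. \<Sum>s\<in>De. \<Sum>k\<in>routes G r s. (f r s k - f' r s k) * (incidence a k * c a))"
    by (intro sum.cong) (simp_all add: x sum_distrib_right sum_distrib_left mult_ac)
  also have "\<dots> = (\<Sum>r\<in>Or. \<Sum>s\<in>De. \<Sum>k\<in>routes G r s.
      (f r s k - f' r s k) * (\<Sum>a\<in>arcs G. incidence a k * c a))"
    unfolding sum_swap_inward by (simp add: sum_distrib_left)
  finally have X: "(\<Sum>a\<in>arcs G. (x a - x' a) * c a) = \<dots>" .
  have Q: "(\<Sum>r\<in>Or. \<Sum>s\<in>De. (q r s - q' r s) * g r s) =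
      (\<Sum>r\<in>Or. \<Sum>s\<in>De. \<Sum>k\<in>routes G r s. (f r s k - f' r s k) * g r s)"
    by (intro sum.cong) (simp_all add: q sum_distrib_right)
  have "(\<Sum>s\<in>De. (d s - d' s) * m s) = (\<Sum>s\<in>De. \<Sum>r\<in>Or. (q r s - q' r s) * m s)"
    by (intro sum.cong) (simp_all add: d sum_distrib_right)
  also have "\<dots> = (\<Sum>r\<in>Or. \<Sum>s\<in>De. (q r s - q' r s) * m s)"
    by (rule sum.swap)
  also have "\<dots> = (\<Sum>r\<in>Or. \<Sum>s\<in>De. \<Sum>k\<in>routes G r s. (f r s k - f' r s k) * m s)"
    by (intro sum.cong) (simp_all add: q sum_distrib_right)
  finally have D: "(\<Sum>s\<in>De. (d s - d' s) * m s) = \<dots>" .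
  show ?thesis
    unfolding X Q D by (simp add: sum.distrib sum_subtractf distrib_left right_diff_distrib)
qed

locale road_network =
  fixes G :: "('v, 'l) pre_digraph"
    and Or De :: "'v set"
    and dem :: "'v \<Rightarrow> real"
    and T \<alpha> \<beta> \<gamma> :: real
  assumes fin_digraph: "fin_digraph G"
    and Or_verts: "Or \<subseteq> verts G"
    and De_verts: "De \<subseteq> verts G" and De_ne: "De \<noteq> {}"
    and routes_ne: "\<And>r s. r \<in> Or \<Longrightarrow> s \<in> De \<Longrightarrow> routes G r s \<noteq> {}"
    and dem_pos: "\<And>r. r \<in> Or \<Longrightarrow> dem r > 0"
    and T_pos: "T > 0"
    and \<alpha>_pos: "\<alpha> > 0" and \<beta>_pos: "\<beta> > 0" and \<gamma>_pos: "\<gamma> > 0"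
begin

lemma finite_arcs: "finite (arcs G)"
  using fin_digraph by (simp add: fin_digraph_def fin_digraph_axioms_def)

lemma finite_Or: "finite Or" and finite_De: "finite De"
  using fin_digraph Or_verts De_verts
  by (auto simp: fin_digraph_def fin_digraph_axioms_def intro: finite_subset)

lemma finite_routes: "finite (routes G r s)"
  using fin_digraph.apaths_finite[OF fin_digraph] by (simp add: routes_def)

lemmas finite_sets = finite_arcs finite_Or finite_De finite_routes

text \<open>
  The logit responses to a given state \<open>x\<close>, \<open>d\<close>, \<open>h\<close>.  Only the link flows, destination
  demands and business flows enter, which is what makes equilibria a fixed-point problem in these.
\<close>

definition trips ::
  "('l \<Rightarrow> real \<Rightarrow> real) \<Rightarrow> ('v \<Rightarrow> real \<Rightarrow> real \<Rightarrow> real) \<Rightarrow> ('l \<Rightarrow> real) \<Rightarrow> ('v \<Rightarrow> real) \<Rightarrow> ('v \<Rightarrow> real) \<Rightarrow>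
    'v \<Rightarrow> 'v \<Rightarrow> real" where
  "trips t A x d h r s =
     dem r * logit De (\<lambda>j. - \<gamma> * (expected_cost G \<alpha> t x r j - A j (d j) (h j))) s"

definition route_flow ::
  "('l \<Rightarrow> real \<Rightarrow> real) \<Rightarrow> ('v \<Rightarrow> real \<Rightarrow> real \<Rightarrow> real) \<Rightarrow> ('l \<Rightarrow> real) \<Rightarrow> ('v \<Rightarrow> real) \<Rightarrow> ('v \<Rightarrow> real) \<Rightarrow>
    'v \<Rightarrow> 'v \<Rightarrow> 'l list \<Rightarrow> real" where
  "route_flow t A x d h r s k =
     trips t A x d h r s * logit (routes G r s) (\<lambda>j. - \<alpha> * route_cost G t x j) k"

definition firms :: "('v \<Rightarrow> real \<Rightarrow> real \<Rightarrow> real) \<Rightarrow> ('v \<Rightarrow> real) \<Rightarrow> ('v \<Rightarrow> real) \<Rightarrow> 'v \<Rightarrow> real" where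
  "firms B d h s = T * logit De (\<lambda>j. \<beta> * B j (d j) (h j)) s"

definition link_load ::
  "('l \<Rightarrow> real \<Rightarrow> real) \<Rightarrow> ('v \<Rightarrow> real \<Rightarrow> real \<Rightarrow> real) \<Rightarrow> ('l \<Rightarrow> real) \<Rightarrow> ('v \<Rightarrow> real) \<Rightarrow> ('v \<Rightarrow> real) \<Rightarrow>
    'l \<Rightarrow> real" where
  "link_load t A x d h a =
     (\<Sum>r\<in>Or. \<Sum>s\<in>De. \<Sum>k\<in>routes G r s. incidence a k * route_flow t A x d h r s k)"

lemma trips_pos: "r \<in> Or \<Longrightarrow> trips t A x d h r s > 0"
  unfolding trips_def by (simp add: dem_pos logit_pos finite_De De_ne)

lemma route_flow_pos: "r \<in> Or \<Longrightarrow> s \<in> De \<Longrightarrow> route_flow t A x d h r s k > 0"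
  unfolding route_flow_def by (simp add: trips_pos logit_pos finite_routes routes_ne)

lemma firms_pos: "firms B d h s > 0"
  unfolding firms_def by (simp add: T_pos logit_pos finite_De De_ne)

lemma sum_trips: "(\<Sum>s\<in>De. trips t A x d h r s) = dem r"
  unfolding trips_def by (simp add: finite_De De_ne sum_logit flip: sum_distrib_left)

lemma sum_route_flow:
  "r \<in> Or \<Longrightarrow> s \<in> De \<Longrightarrow> (\<Sum>k\<in>routes G r s. route_flow t A x d h r s k) = trips t A x d h r s"
  unfolding route_flow_def by (simp add: finite_routes routes_ne sum_logit flip: sum_distrib_left)

lemma sum_firms: "(\<Sum>s\<in>De. firms B d h s) = T"
  unfolding firms_def by (simp add: finite_De De_ne sum_logit flip: sum_distrib_left)

lemma link_load_bounds: "0 \<le> link_load t A x d h a" "link_load t A x d h a \<le> (\<Sum>r\<in>Or. dem r)"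
proof -
  show "0 \<le> link_load t A x d h a"
    unfolding link_load_def
    by (intro sum_nonneg mult_nonneg_nonneg) (auto simp: incidence_def less_imp_le route_flow_pos)
  have "link_load t A x d h a \<le> (\<Sum>r\<in>Or. \<Sum>s\<in>De. \<Sum>k\<in>routes G r s. route_flow t A x d h r s k)"
    unfolding link_load_def
    by (intro sum_mono) (auto simp: incidence_def less_imp_le route_flow_pos)
  also have "\<dots> = (\<Sum>r\<in>Or. dem r)"
    by (simp add: sum_route_flow sum_trips)
  finally show "link_load t A x d h a \<le> (\<Sum>r\<in>Or. dem r)" .
qed

lemma sum_trips_bounds:
  assumes "s \<in> De"
  shows "0 \<le> (\<Sum>r\<in>Or. trips t A x d h r s)" "(\<Sum>r\<in>Or. trips t A x d h r s) \<le> (\<Sum>r\<in>Or. dem r)"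
proof -
  show "0 \<le> (\<Sum>r\<in>Or. trips t A x d h r s)"
    by (intro sum_nonneg) (simp add: less_imp_le trips_pos)
  have "trips t A x d h r s \<le> dem r" if "r \<in> Or" for r
    using member_le_sum[of s De "trips t A x d h r"] that assms
    by (simp add: sum_trips finite_De less_imp_le trips_pos)
  then show "(\<Sum>r\<in>Or. trips t A x d h r s) \<le> (\<Sum>r\<in>Or. dem r)"
    by (rule sum_mono)
qed

lemma firms_le: "s \<in> De \<Longrightarrow> firms B d h s \<le> T"
  using member_le_sum[of s De "firms B d h"]
  by (simp add: sum_firms finite_De less_imp_le firms_pos)

text \<open>
  Logit responses satisfy the nonnegativity and conservation constraints by themselves.  The
  only remaining conditions are that \<open>x\<close>, \<open>d\<close>, \<open>h\<close> reproduce themselves, i.e. a fixed-point equation.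
\<close>

lemma combined_equilibrium_iff:
  "combined_equilibrium G Or De dem T \<alpha> \<beta> \<gamma> t A B (f, x, q, d, h) \<longleftrightarrow>
     (\<forall>r\<in>Or. \<forall>s\<in>De. q r s = trips t A x d h r s) \<and>
     (\<forall>r\<in>Or. \<forall>s\<in>De. \<forall>k\<in>routes G r s. f r s k = route_flow t A x d h r s k) \<and>
     (\<forall>s\<in>De. h s = firms B d h s) \<and>
     (\<forall>a\<in>arcs G. x a = link_load t A x d h a) \<and>
     (\<forall>s\<in>De. d s = (\<Sum>r\<in>Or. trips t A x d h r s))" (is "?E \<longleftrightarrow> ?Q \<and> ?F \<and> ?H \<and> ?X \<and> ?D")
proof -
  define Q where "Q = trips t A x d h"
  define F where "F = route_flow t A x d h"
  define H where "H = firms B d h"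
  define X where "X = link_load t A x d h"
  define L where "L r s = logit (routes G r s) (\<lambda>j. - \<alpha> * route_cost G t x j)" for r s
  have FQ: "F r s k = Q r s * L r s k" for r s k
    by (simp add: F_def Q_def L_def route_flow_def)
  have F_nonneg: "0 \<le> F r s k" if "r \<in> Or" "s \<in> De" for r s k
    using that by (simp add: F_def less_imp_le route_flow_pos)
  have sum_F: "(\<Sum>k\<in>routes G r s. F r s k) = Q r s" if "r \<in> Or" "s \<in> De" for r s
    using that by (simp add: F_def Q_def sum_route_flow)
  have sum_Q: "(\<Sum>s\<in>De. Q r s) = dem r" for r
    by (simp add: Q_def sum_trips)
  have X_sum: "X a = (\<Sum>r\<in>Or. \<Sum>s\<in>De. \<Sum>k\<in>routes G r s. incidence a k * F r s k)" for a
    by (simp add: X_def F_def link_load_def)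
  have H: "0 \<le> H s" "(\<Sum>s\<in>De. H s) = T" for s
    by (auto simp: H_def less_imp_le firms_pos sum_firms)
  have E: "?E \<longleftrightarrow> (f, x, q, d) \<in> K1 G Or De dem \<and> h \<in> K2 De T \<and>
      (\<forall>r\<in>Or. \<forall>s\<in>De. q r s = Q r s) \<and>
      (\<forall>r\<in>Or. \<forall>s\<in>De. \<forall>k\<in>routes G r s. f r s k = q r s * L r s k) \<and>
      (\<forall>s\<in>De. h s = H s)"
    unfolding combined_equilibrium_def Q_def H_def L_def trips_def firms_def logit_def by simp
  have K: "(f, x, q, d) \<in> K1 G Or De dem \<longleftrightarrow>
      (\<forall>a\<in>arcs G. x a = X a) \<and> (\<forall>s\<in>De. d s = (\<Sum>r\<in>Or. Q r s))"
    if "\<forall>r\<in>Or. \<forall>s\<in>De. q r s = Q r s"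
      "\<forall>r\<in>Or. \<forall>s\<in>De. \<forall>k\<in>routes G r s. f r s k = F r s k"
    using that by (auto simp: K1_def X_sum F_nonneg sum_F sum_Q)
  have K': "h \<in> K2 De T" if "\<forall>s\<in>De. h s = H s"
    using that H by (simp add: K2_def)
  show ?thesis
    unfolding Q_def[symmetric] F_def[symmetric] H_def[symmetric] X_def[symmetric]
    unfolding E using K K' by (auto simp: FQ)
qed


section \<open>Solutions of the variational inequalities are marginal-cost equilibria\<close>


text \<open>
  The feasible route flows form a product over the origins of simplices indexed by pairs of a
  destination and a route.  Varying the flows of one origin at a time reduces the
  inequality to these simplices; conversely, a cost that is constant on each of them is orthogonal
  to all feasible differences, as the origin demands are fixed.
\<close>

lemma flow_stationary_iff:
  assumes p': "(f', x', q', d') \<in> K1 G Or De dem"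
    and pos: "\<forall>r\<in>Or. \<forall>s\<in>De. \<forall>k\<in>routes G r s. f' r s k > 0"
  shows "(\<forall>(f, x, q, d) \<in> K1 G Or De dem.
        (\<Sum>r\<in>Or. \<Sum>s\<in>De. \<Sum>k\<in>routes G r s. (f r s k - f' r s k) * l r s k)
        + (\<Sum>a\<in>arcs G. (x a - x' a) * c a)
        + (\<Sum>r\<in>Or. \<Sum>s\<in>De. (q r s - q' r s) * g r s)
        - (\<Sum>s\<in>De. (d s - d' s) * m s) \<ge> 0) \<longleftrightarrow>
      (\<forall>r\<in>Or. \<exists>\<mu>. \<forall>s\<in>De. \<forall>k\<in>routes G r s.
        l r s k + (\<Sum>a\<in>arcs G. incidence a k * c a) + g r s - m s = \<mu>)"
    (is "?VI \<longleftrightarrow> ?const")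
proof -
  define F where "F r s k = l r s k + (\<Sum>a\<in>arcs G. incidence a k * c a) + g r s - m s" for r s k
  have VI: "?VI \<longleftrightarrow> (\<forall>(f, x, q, d) \<in> K1 G Or De dem.
      (\<Sum>r\<in>Or. \<Sum>s\<in>De. \<Sum>k\<in>routes G r s. (f r s k - f' r s k) * F r s k) \<ge> 0)"
  proof (intro ball_cong refl)
    fix p assume p: "p \<in> K1 G Or De dem"
    obtain f x q d where p_eq: "p = (f, x, q, d)" by (cases p) auto
    show "(case p of (f, x, q, d) \<Rightarrow>
        (\<Sum>r\<in>Or. \<Sum>s\<in>De. \<Sum>k\<in>routes G r s. (f r s k - f' r s k) * l r s k)
        + (\<Sum>a\<in>arcs G. (x a - x' a) * c a)
        + (\<Sum>r\<in>Or. \<Sum>s\<in>De. (q r s - q' r s) * g r s)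
        - (\<Sum>s\<in>De. (d s - d' s) * m s) \<ge> 0) \<longleftrightarrow>
      (case p of (f, x, q, d) \<Rightarrow>
        (\<Sum>r\<in>Or. \<Sum>s\<in>De. \<Sum>k\<in>routes G r s. (f r s k - f' r s k) * F r s k) \<ge> 0)"
      unfolding F_def p_eq split_conv
      by (rule arg_cong[where f = "\<lambda>z. z \<ge> 0"]) (rule K1_pairing[OF p[unfolded p_eq] p'])
  qed
  have total': "(\<Sum>s\<in>De. \<Sum>k\<in>routes G r s. f' r s k) = dem r" if "r \<in> Or" for r
    using p' that by (simp add: K1_def)
  show ?thesis
    unfolding VI F_def[symmetric]
  proof (intro iffI ballI)
    fix r assume VI': "\<forall>(f, x, q, d) \<in> K1 G Or De dem.
      (\<Sum>r\<in>Or. \<Sum>s\<in>De. \<Sum>k\<in>routes G r s. (f r s k - f' r s k) * F r s k) \<ge> 0" and r: "r \<in> Or"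
    let ?I = "Sigma De (routes G r)"
    have "\<exists>\<mu>. \<forall>i\<in>?I. (\<lambda>(s, k). F r s k) i = \<mu>"
    proof (rule simplex_stationary[of _ "\<lambda>(s, k). f' r s k"])
      show "finite ?I" by (simp add: finite_sets)
      show "\<And>i. i \<in> ?I \<Longrightarrow> (\<lambda>(s, k). f' r s k) i > 0" using pos r by auto
    next
      fix v :: "'v \<times> 'l list \<Rightarrow> real"
      assume v: "\<And>i. i \<in> ?I \<Longrightarrow> v i \<ge> 0" "(\<Sum>i\<in>?I. v i) = (\<Sum>i\<in>?I. (\<lambda>(s, k). f' r s k) i)"
      \<comment> \<open>Only the flows of origin \<open>r\<close> are changed; the other components follow them.\<close>
      define f where "f r0 s k = (if r0 = r then v (s, k) else f' r0 s k)" for r0 s k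
      define q where "q r0 s = (\<Sum>k\<in>routes G r0 s. f r0 s k)" for r0 s
      define x where "x a = (\<Sum>r\<in>Or. \<Sum>s\<in>De. \<Sum>k\<in>routes G r s. incidence a k * f r s k)" for a
      define d where "d s = (\<Sum>r\<in>Or. q r s)" for s
      have "(\<Sum>s\<in>De. q r s) = dem r"
        unfolding q_def f_def total'[OF r, symmetric] using v(2)
        by (simp add: sum.Sigma finite_sets)
      moreover have "(\<Sum>s\<in>De. q r0 s) = dem r0" if "r0 \<in> Or" "r0 \<noteq> r" for r0
        using that total' by (simp add: q_def f_def)
      moreover have "f r0 s k \<ge> 0" if "r0 \<in> Or" "s \<in> De" "k \<in> routes G r0 s" for r0 s k
        using that v(1) pos by (auto simp: f_def less_imp_le)
      ultimately have "(f, x, q, d) \<in> K1 G Or De dem"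
        unfolding K1_def by (auto simp: q_def x_def d_def)
      from bspec[OF VI' this]
      have "0 \<le> (\<Sum>r\<in>Or. \<Sum>s\<in>De. \<Sum>k\<in>routes G r s. (f r s k - f' r s k) * F r s k)"
        by (simp only: split_conv)
      also have "\<dots> = (\<Sum>r0\<in>Or. if r0 = r
          then \<Sum>s\<in>De. \<Sum>k\<in>routes G r s. (v (s, k) - f' r s k) * F r s k else 0)"
        by (intro sum.cong) (auto simp: f_def)
      also have "\<dots> = (\<Sum>s\<in>De. \<Sum>k\<in>routes G r s. (v (s, k) - f' r s k) * F r s k)"
        using r by (simp add: finite_Or)
      finally show "0 \<le> (\<Sum>i\<in>?I. (v i - (\<lambda>(s, k). f' r s k) i) * (\<lambda>(s, k). F r s k) i)"
        by (simp add: sum.Sigma finite_sets case_prod_unfold)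
    qed
    then show "\<exists>\<mu>. \<forall>s\<in>De. \<forall>k\<in>routes G r s. F r s k = \<mu>" by fastforce
  next
    fix p assume const: "\<forall>r\<in>Or. \<exists>\<mu>. \<forall>s\<in>De. \<forall>k\<in>routes G r s. F r s k = \<mu>"
      and p: "p \<in> K1 G Or De dem"
    obtain f x q d where p_eq: "p = (f, x, q, d)" by (cases p) auto
    have "(\<Sum>s\<in>De. \<Sum>k\<in>routes G r s. (f r s k - f' r s k) * F r s k) = 0" if r: "r \<in> Or" for r
    proof -
      from bspec[OF const r] obtain \<mu>
        where \<mu>: "\<forall>s\<in>De. \<forall>k\<in>routes G r s. F r s k = \<mu>" by (rule exE)
      have total: "(\<Sum>s\<in>De. \<Sum>k\<in>routes G r s. f r s k) = dem r"
        using p r by (simp add: p_eq K1_def)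
      have "(\<Sum>s\<in>De. \<Sum>k\<in>routes G r s. (f r s k - f' r s k) * F r s k) =
          ((\<Sum>s\<in>De. \<Sum>k\<in>routes G r s. f r s k) - (\<Sum>s\<in>De. \<Sum>k\<in>routes G r s. f' r s k)) * \<mu>"
        by (simp add: \<mu> sum_distrib_right left_diff_distrib sum_subtractf)
      then show ?thesis by (simp add: total total' r)
    qed
    then show "case p of (f, x, q, d) \<Rightarrow>
        (\<Sum>r\<in>Or. \<Sum>s\<in>De. \<Sum>k\<in>routes G r s. (f r s k - f' r s k) * F r s k) \<ge> 0"
      by (simp add: p_eq)
  qed
qed

lemma firms_stationary_iff:
  assumes h': "h' \<in> K2 De T" and pos: "\<forall>s\<in>De. h' s > 0"
  shows "(\<forall>h \<in> K2 De T. (\<Sum>s\<in>De. (h s - h' s) * ((1 / \<beta>) * ln (h' s) - b s)) \<ge> 0) \<longleftrightarrow>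
    (\<forall>s\<in>De. h' s = T * logit De (\<lambda>j. \<beta> * b j) s)" (is "?VI \<longleftrightarrow> ?logit")
proof -
  have total': "(\<Sum>s\<in>De. h' s) = T" using h' by (simp add: K2_def)
  have logit: "?logit \<longleftrightarrow> (\<exists>l. \<forall>s\<in>De. ln (h' s) - \<beta> * b s = l)"
    by (intro eq_logit_iff) (auto simp: finite_De De_ne pos total')
  show ?thesis
    unfolding logit
  proof
    assume VI: ?VI
    have "\<exists>l. \<forall>s\<in>De. (1 / \<beta>) * ln (h' s) - b s = l"
      using VI pos by (intro simplex_stationary[of De h']) (auto simp: finite_De K2_def total')
    then obtain l where "\<And>s. s \<in> De \<Longrightarrow> (1 / \<beta>) * ln (h' s) - b s = l" by blast
    then have "\<forall>s\<in>De. ln (h' s) - \<beta> * b s = \<beta> * l"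
      using \<beta>_pos by (auto simp: field_simps)
    then show "\<exists>l. \<forall>s\<in>De. ln (h' s) - \<beta> * b s = l" by blast
  next
    assume "\<exists>l. \<forall>s\<in>De. ln (h' s) - \<beta> * b s = l"
    then obtain l where "\<And>s. s \<in> De \<Longrightarrow> ln (h' s) - \<beta> * b s = l" by blast
    then have l: "(1 / \<beta>) * ln (h' s) - b s = (1 / \<beta>) * l" if "s \<in> De" for s
      using \<beta>_pos that by (force simp: field_simps)
    show ?VI
    proof
      fix h assume h: "h \<in> K2 De T"
      have "(\<Sum>s\<in>De. (h s - h' s) * ((1 / \<beta>) * ln (h' s) - b s)) =
          ((\<Sum>s\<in>De. h s) - (\<Sum>s\<in>De. h' s)) * ((1 / \<beta>) * l)"
        unfolding sum_subtractf[symmetric] sum_distrib_right by (intro sum.cong refl arg_cong2[where f = "(*)"]) (rule l)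
      then show "(\<Sum>s\<in>De. (h s - h' s) * ((1 / \<beta>) * ln (h' s) - b s)) \<ge> 0"
        using h total' by (simp add: K2_def)
    qed
  qed
qed

text \<open>
  Solutions are positive by definition, equilibria because logit shares are.  Given positivity, the
  two inequalities separate into the nested logit for travelers and the simple logit for firms.
\<close>

lemma VI_solutions_iff_equilibrium:
  "(f, x, q, d, h) \<in> VI_solutions G Or De dem T \<alpha> \<beta> \<gamma> t A B \<longleftrightarrow>
   combined_equilibrium G Or De dem T \<alpha> \<beta> \<gamma> (marginal_time t) (marginal_attraction A) B (f, x, q, d, h)"
  (is "?VI \<longleftrightarrow> ?E")
proof (cases "(f, x, q, d) \<in> K1 G Or De dem \<and> h \<in> K2 De T \<and>
     (\<forall>r\<in>Or. \<forall>s\<in>De. \<forall>k\<in>routes G r s. f r s k > 0) \<and>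
     (\<forall>r\<in>Or. \<forall>s\<in>De. q r s > 0) \<and> (\<forall>s\<in>De. h s > 0)")
  case True
  then have p: "(f, x, q, d) \<in> K1 G Or De dem" and h: "h \<in> K2 De T"
    and fpos: "\<forall>r\<in>Or. \<forall>s\<in>De. \<forall>k\<in>routes G r s. f r s k > 0"
    and qpos: "\<forall>r\<in>Or. \<forall>s\<in>De. q r s > 0"
    and hpos: "\<forall>s\<in>De. h s > 0" by auto
  let ?C = "route_cost G (marginal_time t) x" and ?m = "\<lambda>s. marginal_attraction A s (d s) (h s)"
  let ?v = "\<lambda>r s. expected_cost G \<alpha> (marginal_time t) x r s"
  have flows: "(\<exists>l. \<forall>s\<in>De. \<forall>k\<in>routes G r s.
        (1 / \<alpha>) * ln (f r s k) + ?C k + (1 / \<gamma> - 1 / \<alpha>) * ln (q r s) - ?m s = l) \<longleftrightarrow>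
      (\<forall>s\<in>De. q r s = dem r * logit De (\<lambda>s. - \<gamma> * (?v r s - ?m s)) s) \<and>
      (\<forall>s\<in>De. \<forall>k\<in>routes G r s. f r s k = q r s * logit (routes G r s) (\<lambda>k. - \<alpha> * ?C k) k)"
    if r: "r \<in> Or" for r
    unfolding expected_cost_def
    using p r by (intro nested_logit_iff)
      (auto simp: finite_sets De_ne routes_ne fpos qpos \<alpha>_pos \<gamma>_pos K1_def)
  have E: "?E \<longleftrightarrow> (\<forall>r\<in>Or.
        (\<forall>s\<in>De. q r s = dem r * logit De (\<lambda>s. - \<gamma> * (?v r s - ?m s)) s) \<and>
        (\<forall>s\<in>De. \<forall>k\<in>routes G r s. f r s k = q r s * logit (routes G r s) (\<lambda>k. - \<alpha> * ?C k) k)) \<and>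
      (\<forall>s\<in>De. h s = T * logit De (\<lambda>j. \<beta> * B j (d j) (h j)) s)"
    unfolding combined_equilibrium_def logit_def split_conv ball_conj_distrib using p h by simp
  have "?VI \<longleftrightarrow> (\<forall>r\<in>Or. \<exists>l. \<forall>s\<in>De. \<forall>k\<in>routes G r s.
        (1 / \<alpha>) * ln (f r s k) + ?C k + (1 / \<gamma> - 1 / \<alpha>) * ln (q r s) - ?m s = l) \<and>
      (\<forall>s\<in>De. h s = T * logit De (\<lambda>j. \<beta> * B j (d j) (h j)) s)"
    unfolding route_cost_def
      flow_stationary_iff[OF p fpos, of "\<lambda>r s k. (1 / \<alpha>) * ln (f r s k)" "\<lambda>a. marginal_time t a (x a)"
        "\<lambda>r s. (1 / \<gamma> - 1 / \<alpha>) * ln (q r s)" ?m, symmetric]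
      firms_stationary_iff[OF h hpos, symmetric]
    unfolding VI_solutions_def marginal_time_def marginal_attraction_def using True by simp
  also have "\<dots> \<longleftrightarrow> ?E"
    by (simp only: flows E cong: ball_cong)
  finally show ?thesis .
next
  case False
  have "\<not> ?E"
  proof
    assume E: ?E
    then have "(f, x, q, d) \<in> K1 G Or De dem" "h \<in> K2 De T"
      by (simp_all add: combined_equilibrium_def)
    moreover have "\<forall>r\<in>Or. \<forall>s\<in>De. q r s > 0" "\<forall>r\<in>Or. \<forall>s\<in>De. \<forall>k\<in>routes G r s. f r s k > 0"
      "\<forall>s\<in>De. h s > 0"
      using E unfolding combined_equilibrium_iff
      by (metis trips_pos, metis route_flow_pos, metis firms_pos)
    ultimately show False using False by blast
  qed
  then show ?thesis using False by (auto simp: VI_solutions_def)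
qed


section \<open>Existence of a cost-minimal equilibrium\<close>


lemma expected_cost_cong:
  "(\<And>a. a \<in> arcs G \<Longrightarrow> t a (x a) = t' a (x' a)) \<Longrightarrow>
    expected_cost G \<alpha> t x r s = expected_cost G \<alpha> t' x' r s"
  by (simp add: expected_cost_def route_cost_def)

lemma trips_cong:
  assumes "\<And>a. a \<in> arcs G \<Longrightarrow> t a (x a) = t' a (x' a)"
    and "\<And>s. s \<in> De \<Longrightarrow> A s (d s) (h s) = A' s (d' s) (h' s)"
    and "s \<in> De"
  shows "trips t A x d h r s = trips t' A' x' d' h' r s"
  unfolding trips_def using assms
  by (intro arg_cong2[where f = "(*)"] refl logit_cong) (simp_all add: expected_cost_cong[of t x t' x'])

lemma route_flow_cong:
  assumes "\<And>a. a \<in> arcs G \<Longrightarrow> t a (x a) = t' a (x' a)"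
    and "\<And>s. s \<in> De \<Longrightarrow> A s (d s) (h s) = A' s (d' s) (h' s)"
    and "s \<in> De"
  shows "route_flow t A x d h r s k = route_flow t' A' x' d' h' r s k"
proof -
  have "route_cost G t x j = route_cost G t' x' j" for j
    by (simp add: route_cost_def assms(1))
  then show ?thesis
    unfolding route_flow_def using trips_cong[of t x t' x' A d h A' d' h', OF assms] by simp
qed

lemma link_load_cong:
  assumes "\<And>a. a \<in> arcs G \<Longrightarrow> t a (x a) = t' a (x' a)"
    and "\<And>s. s \<in> De \<Longrightarrow> A s (d s) (h s) = A' s (d' s) (h' s)"
  shows "link_load t A x d h a = link_load t' A' x' d' h' a"
  unfolding link_load_def
  by (intro sum.cong refl arg_cong2[where f = "(*)"] route_flow_cong assms)

lemma firms_cong: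
  assumes "\<And>s. s \<in> De \<Longrightarrow> B s (d s) (h s) = B s (d' s) (h' s)" and "s \<in> De"
  shows "firms B d h s = firms B d' h' s"
  unfolding firms_def using assms by (intro arg_cong2[where f = "(*)"] refl logit_cong) simp_all

text \<open>
  An equilibrium depends on the model functions only through their values at the state itself.
  This is why constant tolls can imitate marginal functions.
\<close>

lemma combined_equilibrium_cong:
  assumes "\<And>a. a \<in> arcs G \<Longrightarrow> t a (x a) = t' a (x a)"
    and "\<And>s. s \<in> De \<Longrightarrow> A s (d s) (h s) = A' s (d s) (h s)"
  shows "combined_equilibrium G Or De dem T \<alpha> \<beta> \<gamma> t A B (f, x, q, d, h) \<longleftrightarrow>
    combined_equilibrium G Or De dem T \<alpha> \<beta> \<gamma> t' A' B (f, x, q, d, h)"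
proof -
  have "trips t A x d h r s = trips t' A' x d h r s" if "s \<in> De" for r s
    using assms that by (rule trips_cong)
  moreover have "route_flow t A x d h r s k = route_flow t' A' x d h r s k" if "s \<in> De" for r s k
    using assms that by (rule route_flow_cong)
  moreover have "link_load t A x d h a = link_load t' A' x d h a" for a
    using assms by (rule link_load_cong)
  ultimately show ?thesis
    unfolding combined_equilibrium_iff by (simp cong: ball_cong)
qed

lemma continuous_on_route_cost:
  assumes "\<And>a. a \<in> arcs G \<Longrightarrow> continuous_on S (\<lambda>u. t a (X u a))"
  shows "continuous_on S (\<lambda>u. route_cost G t (X u) k)"
  unfolding route_cost_def by (intro continuous_intros assms)

lemma continuous_on_trips:
  assumes t: "\<And>a. a \<in> arcs G \<Longrightarrow> continuous_on S (\<lambda>u. t a (X u a))"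
    and A: "\<And>s. s \<in> De \<Longrightarrow> continuous_on S (\<lambda>u. A s (D u s) (H u s))"
    and "r \<in> Or" "s \<in> De"
  shows "continuous_on S (\<lambda>u. trips t A (X u) (D u) (H u) r s)"
proof -
  have "continuous_on S (\<lambda>u. expected_cost G \<alpha> t (X u) r j)" if "j \<in> De" for j
    unfolding expected_cost_def using sum_exp_pos[OF finite_routes routes_ne[OF \<open>r \<in> Or\<close> that]]
    by (intro continuous_intros continuous_on_route_cost t) (auto simp: less_imp_neq[symmetric])
  then show ?thesis
    unfolding trips_def using assms
    by (intro continuous_on_mult_left continuous_on_logit continuous_on_diff)
       (auto simp: finite_De De_ne)
qed

lemma continuous_on_route_flow:
  assumes t: "\<And>a. a \<in> arcs G \<Longrightarrow> continuous_on S (\<lambda>u. t a (X u a))"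
    and A: "\<And>s. s \<in> De \<Longrightarrow> continuous_on S (\<lambda>u. A s (D u s) (H u s))"
    and "r \<in> Or" "s \<in> De" "k \<in> routes G r s"
  shows "continuous_on S (\<lambda>u. route_flow t A (X u) (D u) (H u) r s k)"
  unfolding route_flow_def using assms(3-)
  by (intro continuous_on_mult continuous_on_trips continuous_on_logit continuous_on_mult_left
      continuous_on_route_cost t A) (auto simp: finite_routes)

lemma continuous_on_firms:
  assumes "\<And>s. s \<in> De \<Longrightarrow> continuous_on S (\<lambda>u. B s (D u s) (H u s))" "s \<in> De"
  shows "continuous_on S (\<lambda>u. firms B (D u) (H u) s)"
  unfolding firms_def using assms
  by (intro continuous_on_mult_left continuous_on_logit) (auto simp: finite_De De_ne)

text \<open>
  The functions \<open>t0\<close> and \<open>A0\<close> that define the cost are separate from those that define the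
  equilibria, because the latter will be the marginal functions.  Responses are feasible
  whatever state they respond to, so every link flow and destination demand they produce is
  bounded by the total demand and every business flow by \<open>T\<close>.  This yields a cube that is mapped
  into itself.
\<close>

lemma ex_cost_minimal_equilibrium:
  assumes t: "\<And>a. a \<in> arcs G \<Longrightarrow> continuous_on {0..} (t a)"
    and A: "\<And>s. s \<in> De \<Longrightarrow> continuous_on ({0..} \<times> {0..}) (\<lambda>(y, h). A s y h)"
    and B: "\<And>s. s \<in> De \<Longrightarrow> continuous_on ({0..} \<times> {0..}) (\<lambda>(y, h). B s y h)"
    and t0: "\<And>a. a \<in> arcs G \<Longrightarrow> continuous_on {0..} (t0 a)"
    and A0: "\<And>s. s \<in> De \<Longrightarrow> continuous_on ({0..} \<times> {0..}) (\<lambda>(y, h). A0 s y h)"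
  shows "\<exists>p. is_arg_min (social_cost G Or De \<alpha> \<gamma> t0 A0)
    (\<lambda>p. combined_equilibrium G Or De dem T \<alpha> \<beta> \<gamma> t A B p) p"
proof -
  define M where "M = (\<Sum>r\<in>Or. dem r) + T"
  have dem_sum: "0 \<le> (\<Sum>r\<in>Or. dem r)"
    by (intro sum_nonneg) (simp add: dem_pos less_imp_le)
  then have M: "M > 0" and M_dem: "(\<Sum>r\<in>Or. dem r) \<le> M" and M_T: "T \<le> M"
    using T_pos by (simp_all add: M_def)
  define I where "I = arcs G <+> (De <+> De)"
  have I: "finite I" by (simp add: I_def finite_sets)
  define X where "X u = (\<lambda>a. u (Inl a))" for u :: "'l + 'v + 'v \<Rightarrow> real"
  define D where "D u = (\<lambda>s. u (Inr (Inl s)))" for u :: "'l + 'v + 'v \<Rightarrow> real"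
  define H where "H u = (\<lambda>s. u (Inr (Inr s)))" for u :: "'l + 'v + 'v \<Rightarrow> real"
  define \<Phi> where "\<Phi> u i = (case i of
      Inl a \<Rightarrow> link_load t A (X u) (D u) (H u) a
    | Inr (Inl s) \<Rightarrow> \<Sum>r\<in>Or. trips t A (X u) (D u) (H u) r s
    | Inr (Inr s) \<Rightarrow> firms B (D u) (H u) s)" for u i
  define state where "state u = (route_flow t A (X u) (D u) (H u), X u,
      trips t A (X u) (D u) (H u), D u, H u)" for u
  let ?C = "cube I M"
  have nonneg: "0 \<le> u i" if "u \<in> ?C" for u i
    using that[unfolded cube_def mem_Collect_eq, rule_format, of i] by (simp split: if_splits)
  have link: "continuous_on ?C (\<lambda>u. g (X u a))" if "continuous_on {0..} g" for g a
    unfolding X_def using nonneg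
    by (intro continuous_on_compose2[OF that] continuous_intros) auto
  have center: "continuous_on ?C (\<lambda>u. F (D u s) (H u s))"
    if "continuous_on ({0..} \<times> {0..}) (\<lambda>(y, h). F y h)" for F s
  proof -
    have "continuous_on ?C (\<lambda>u. case (D u s, H u s) of (y, h) \<Rightarrow> F y h)"
      unfolding D_def H_def using nonneg
      by (intro continuous_on_compose2[OF that] continuous_intros) auto
    then show ?thesis by simp
  qed
  have cont_trips: "continuous_on ?C (\<lambda>u. trips t A (X u) (D u) (H u) r s)"
    if "r \<in> Or" "s \<in> De" for r s
    using that by (intro continuous_on_trips link center t A)
  have cont_flow: "continuous_on ?C (\<lambda>u. route_flow t A (X u) (D u) (H u) r s k)"
    if "r \<in> Or" "s \<in> De" "k \<in> routes G r s" for r s k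
    using that by (intro continuous_on_route_flow link center t A)
  have cont_\<Phi>: "continuous_on ?C (\<lambda>u. \<Phi> u i)" if "i \<in> I" for i
  proof -
    have "continuous_on ?C (\<lambda>u. link_load t A (X u) (D u) (H u) a)" for a
      unfolding link_load_def by (intro continuous_intros cont_flow)
    moreover have "continuous_on ?C (\<lambda>u. \<Sum>r\<in>Or. trips t A (X u) (D u) (H u) r s)" if "s \<in> De" for s
      using that by (intro continuous_intros cont_trips)
    moreover have "continuous_on ?C (\<lambda>u. firms B (D u) (H u) s)" if "s \<in> De" for s
      using that by (intro continuous_on_firms center B)
    ultimately show ?thesis
      using that by (auto simp: \<Phi>_def I_def)
  qed
  have \<Phi>_maps: "\<Phi> u i \<in> {0..M}" if "i \<in> I" for u i
    using that order_trans[OF link_load_bounds(2) M_dem] order_trans[OF sum_trips_bounds(2) M_dem]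
      order_trans[OF firms_le M_T]
    by (auto simp: \<Phi>_def I_def link_load_bounds sum_trips_bounds firms_pos less_imp_le)
  define Fix where "Fix = {u \<in> ?C. (\<Sum>i\<in>I. \<bar>\<Phi> u i - u i\<bar>) = 0}"
  have Fix_iff: "u \<in> Fix \<longleftrightarrow> u \<in> ?C \<and> (\<forall>i\<in>I. \<Phi> u i = u i)" for u
    unfolding Fix_def using I by (auto simp: sum_nonneg_eq_0_iff)
  have compact_Fix: "compact Fix"
  proof -
    have "closed Fix"
      unfolding Fix_def
      by (intro continuous_closed_preimage_constant continuous_intros cont_\<Phi> closed_cube)
    then have "compact (?C \<inter> Fix)" by (rule compact_Int_closed[OF compact_cube])
    moreover have "?C \<inter> Fix = Fix" by (auto simp: Fix_def)
    ultimately show ?thesis by simp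
  qed
  have Fix_ne: "Fix \<noteq> {}"
  proof (rule brouwer_cube_finite[OF I M, of \<Phi>])
    fix u assume "u \<in> ?C" "\<And>i. i \<in> I \<Longrightarrow> \<Phi> u i = u i"
    then have "u \<in> Fix" by (simp add: Fix_iff)
    then show "Fix \<noteq> {}" by blast
  next
    show "\<And>i. i \<in> I \<Longrightarrow> continuous_on ?C (\<lambda>u. \<Phi> u i)" by (rule cont_\<Phi>)
    show "\<And>u i. i \<in> I \<Longrightarrow> \<Phi> u i \<in> {0..M}" by (rule \<Phi>_maps)
  qed
  have cont_Z: "continuous_on Fix (\<lambda>u. social_cost G Or De \<alpha> \<gamma> t0 A0 (state u))"
  proof (rule continuous_on_subset)
    \<comment> \<open>Positivity of the flows keeps the logarithms away from their singularity.\<close>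
    have entropy: "continuous_on ?C (\<lambda>u. g u * (ln (g u) - 1))"
      if "continuous_on ?C g" "\<And>u. g u > 0" for g :: "_ \<Rightarrow> real"
      by (intro continuous_intros that(1) ballI) (metis that(2) less_irrefl)
    have cont_X: "continuous_on ?C (\<lambda>u. X u a)" and cont_D: "continuous_on ?C (\<lambda>u. D u s)" for a s
      unfolding X_def D_def by (rule continuous_on_coordinate)+
    have "continuous_on ?C (\<lambda>u. \<Sum>r\<in>Or. \<Sum>s\<in>De. \<Sum>k\<in>routes G r s.
        route_flow t A (X u) (D u) (H u) r s k * (ln (route_flow t A (X u) (D u) (H u) r s k) - 1))"
      by (intro continuous_on_sum entropy cont_flow route_flow_pos)
    moreover have "continuous_on ?C (\<lambda>u. \<Sum>r\<in>Or. \<Sum>s\<in>De.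
        trips t A (X u) (D u) (H u) r s * (ln (trips t A (X u) (D u) (H u) r s) - 1))"
      by (intro continuous_on_sum entropy cont_trips trips_pos)
    moreover have "continuous_on ?C (\<lambda>u. \<Sum>a\<in>arcs G. X u a * t0 a (X u a))"
      by (intro continuous_on_sum continuous_on_mult[OF cont_X link[OF t0]])
    moreover have "continuous_on ?C (\<lambda>u. \<Sum>s\<in>De. A0 s (D u s) (H u s) * D u s)"
      by (intro continuous_on_sum continuous_on_mult[OF center[OF A0] cont_D])
    ultimately show "continuous_on ?C (\<lambda>u. social_cost G Or De \<alpha> \<gamma> t0 A0 (state u))"
      unfolding social_cost_def state_def split_conv
      by (intro continuous_on_add continuous_on_diff continuous_on_mult_left)
    show "Fix \<subseteq> ?C" by (auto simp: Fix_def)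
  qed
  obtain u where u: "u \<in> Fix"
    and least: "\<forall>v\<in>Fix.
      social_cost G Or De \<alpha> \<gamma> t0 A0 (state u) \<le> social_cost G Or De \<alpha> \<gamma> t0 A0 (state v)"
    using continuous_attains_inf[OF compact_Fix Fix_ne cont_Z] by (rule bexE)
  have equilibrium: "combined_equilibrium G Or De dem T \<alpha> \<beta> \<gamma> t A B (state u)"
  proof -
    have fp: "\<And>i. i \<in> I \<Longrightarrow> \<Phi> u i = u i" using u by (simp add: Fix_iff)
    have "X u a = link_load t A (X u) (D u) (H u) a" if "a \<in> arcs G" for a
      using fp[of "Inl a"] that by (simp add: I_def \<Phi>_def X_def[of u] InlI InrI)
    moreover have "D u s = (\<Sum>r\<in>Or. trips t A (X u) (D u) (H u) r s)" if "s \<in> De" for s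
      using fp[of "Inr (Inl s)"] that by (simp add: I_def \<Phi>_def D_def[of u] InlI InrI)
    moreover have "H u s = firms B (D u) (H u) s" if "s \<in> De" for s
      using fp[of "Inr (Inr s)"] that by (simp add: I_def \<Phi>_def H_def[of u] InlI InrI)
    ultimately show ?thesis
      unfolding state_def combined_equilibrium_iff by blast
  qed
  have represented: "\<exists>v\<in>Fix. social_cost G Or De \<alpha> \<gamma> t0 A0 p = social_cost G Or De \<alpha> \<gamma> t0 A0 (state v)"
    if p: "combined_equilibrium G Or De dem T \<alpha> \<beta> \<gamma> t A B p" for p
  proof -
    obtain f x q d h where p_eq: "p = (f, x, q, d, h)" by (cases p) auto
    \<comment> \<open>States are unconstrained off the index sets; setting those values to zero lands in the cube.\<close>
    define v where "v i = (case i of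
        Inl a \<Rightarrow> if a \<in> arcs G then x a else 0
      | Inr (Inl s) \<Rightarrow> if s \<in> De then d s else 0
      | Inr (Inr s) \<Rightarrow> if s \<in> De then h s else 0)" for i :: "'l + 'v + 'v"
    have coords: "X v a = (if a \<in> arcs G then x a else 0)"
      "D v s = (if s \<in> De then d s else 0)" "H v s = (if s \<in> De then h s else 0)" for a s
      by (simp_all add: X_def D_def H_def v_def)
    have flow: "route_flow t A (X v) (D v) (H v) r s k = route_flow t A x d h r s k"
      and trip: "trips t A (X v) (D v) (H v) r s = trips t A x d h r s"
      and firm: "firms B (D v) (H v) s = firms B d h s" if "s \<in> De" for r s k
      using that by (auto intro: route_flow_cong trips_cong firms_cong simp: coords)
    have load: "link_load t A (X v) (D v) (H v) a = link_load t A x d h a" for a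
      by (rule link_load_cong) (auto simp: coords)
    note eq = p[unfolded p_eq combined_equilibrium_iff]
    have fp: "\<Phi> v i = v i" if "i \<in> I" for i
      using that unfolding I_def
    proof (elim PlusE)
      fix a assume "i = Inl a" "a \<in> arcs G"
      moreover have "x a = link_load t A x d h a" using eq \<open>a \<in> arcs G\<close> by blast
      ultimately show ?thesis by (simp only: \<Phi>_def v_def load sum.case if_True)
    next
      fix j s assume "i = Inr j" "j = Inl s" "s \<in> De"
      moreover have "d s = (\<Sum>r\<in>Or. trips t A x d h r s)" using eq \<open>s \<in> De\<close> by blast
      ultimately show ?thesis by (simp only: \<Phi>_def v_def trip sum.case if_True)
    next
      fix j s assume "i = Inr j" "j = Inr s" "s \<in> De"
      moreover have "h s = firms B d h s" using eq \<open>s \<in> De\<close> by blast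
      ultimately show ?thesis by (simp only: \<Phi>_def v_def firm sum.case if_True)
    qed
    have "v \<in> ?C"
    proof -
      have "v i \<in> {0..M}" if "i \<in> I" for i
        using \<Phi>_maps[OF that, of v] fp[OF that] by simp
      moreover have "v i = 0" if "i \<notin> I" for i
        using that by (auto simp: v_def I_def split: sum.splits)
      ultimately show ?thesis by (simp add: cube_def)
    qed
    then have "v \<in> Fix" using fp by (simp add: Fix_iff)
    moreover have "social_cost G Or De \<alpha> \<gamma> t0 A0 p = social_cost G Or De \<alpha> \<gamma> t0 A0 (state v)"
    proof -
      have "f r s k = route_flow t A (X v) (D v) (H v) r s k"
        if "r \<in> Or" "s \<in> De" "k \<in> routes G r s" for r s k
        using eq that by (metis flow)
      moreover have "q r s = trips t A (X v) (D v) (H v) r s" if "r \<in> Or" "s \<in> De" for r s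
        using eq that by (metis trip)
      ultimately show ?thesis
        by (simp add: p_eq state_def social_cost_def coords)
    qed
    ultimately show ?thesis by blast
  qed
  show ?thesis
    unfolding is_arg_min_linorder
  proof (intro exI[of _ "state u"] conjI allI impI equilibrium)
    fix p assume "combined_equilibrium G Or De dem T \<alpha> \<beta> \<gamma> t A B p"
    from represented[OF this] obtain v where "v \<in> Fix"
      "social_cost G Or De \<alpha> \<gamma> t0 A0 p = social_cost G Or De \<alpha> \<gamma> t0 A0 (state v)"
      by (rule bexE)
    with least show "social_cost G Or De \<alpha> \<gamma> t0 A0 (state u) \<le> social_cost G Or De \<alpha> \<gamma> t0 A0 p"
      by simp
  qed
qed

end


section \<open>The optimal road pricing scheme\<close>

theorem mainTheorem7:
  fixes G :: "('v, 'l) pre_digraph"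
    and Or De :: "'v set"
    and dem :: "'v \<Rightarrow> real"
    and T \<alpha> \<beta> \<gamma> :: real
    and t :: "'l \<Rightarrow> real \<Rightarrow> real"
    and A B :: "'v \<Rightarrow> real \<Rightarrow> real \<Rightarrow> real"
  assumes "fin_digraph G"
    and "Or \<subseteq> verts G" and "Or \<noteq> {}"
    and "De \<subseteq> verts G" and "De \<noteq> {}"
    and "\<And>r s. r \<in> Or \<Longrightarrow> s \<in> De \<Longrightarrow> routes G r s \<noteq> {}"
    and "\<And>r. r \<in> Or \<Longrightarrow> dem r > 0"
    and "T > 0"
    and "\<alpha> > 0" and "\<beta> > 0" and "\<gamma> > 0" and "\<alpha> \<ge> \<gamma>"
    and "\<And>a. a \<in> arcs G \<Longrightarrow> link_time_function (t a)"
    and "\<And>s. s \<in> De \<Longrightarrow> trip_attraction_function (A s)"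
    and "\<And>s. s \<in> De \<Longrightarrow> business_attraction_function (B s)"
  shows "(\<exists>p. is_arg_min (social_cost G Or De \<alpha> \<gamma> t A)
                (\<lambda>p. p \<in> VI_solutions G Or De dem T \<alpha> \<beta> \<gamma> t A B) p) \<and>
         (\<forall>f x q d h \<tau> \<pi>.
            is_arg_min (social_cost G Or De \<alpha> \<gamma> t A)
              (\<lambda>p. p \<in> VI_solutions G Or De dem T \<alpha> \<beta> \<gamma> t A B) (f, x, q, d, h) \<longrightarrow>
            (\<forall>a\<in>arcs G. \<tau> a = x a * nn_deriv (t a) (x a)) \<longrightarrow>
            (\<forall>s\<in>De. \<pi> s = - d s * nn_deriv (\<lambda>y. A s y (h s)) (d s)) \<longrightarrow>
            combined_equilibrium G Or De dem T \<alpha> \<beta> \<gamma>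
              (\<lambda>a y. t a y + \<tau> a) (\<lambda>s y z. A s y z - \<pi> s) B (f, x, q, d, h))"
proof -
  interpret road_network G Or De dem T \<alpha> \<beta> \<gamma>
    by (intro road_network.intro assms)
  let ?E = "combined_equilibrium G Or De dem T \<alpha> \<beta> \<gamma>"
  have VI: "VI_solutions G Or De dem T \<alpha> \<beta> \<gamma> t A B = {p. ?E (marginal_time t) (marginal_attraction A) B p}"
    using VI_solutions_iff_equilibrium by auto
  have t: "continuous_on {0..} (t a)" "continuous_on {0..} (marginal_time t a)" if "a \<in> arcs G" for a
  proof -
    have "nn_C1 (t a)" using assms that by (simp add: link_time_function_def)
    note C1 = nn_C1_continuous[OF this]
    then show "continuous_on {0..} (t a)" by simp
    have "marginal_time t a = (\<lambda>y. t a y + y * nn_deriv (t a) y)"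
      by (simp add: marginal_time_def fun_eq_iff)
    then show "continuous_on {0..} (marginal_time t a)"
      using C1 by (auto intro!: continuous_intros)
  qed
  have A: "continuous_on ({0..} \<times> {0..}) (\<lambda>(y, h). A s y h)"
    "continuous_on ({0..} \<times> {0..}) (\<lambda>(y, h). marginal_attraction A s y h)" if "s \<in> De" for s
  proof -
    have "nn_C1_2 (A s)" using assms that by (simp add: trip_attraction_function_def)
    note C1 = nn_C1_2_continuous[OF this]
    then show "continuous_on ({0..} \<times> {0..}) (\<lambda>(y, h). A s y h)" by simp
    show "continuous_on ({0..} \<times> {0..}) (\<lambda>(y, h). marginal_attraction A s y h)"
      using C1 unfolding marginal_attraction_def case_prod_unfold by (auto intro!: continuous_intros)
  qed
  have B: "continuous_on ({0..} \<times> {0..}) (\<lambda>(y, h). B s y h)" if "s \<in> De" for s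
    using assms that nn_C1_2_continuous(1) by (simp add: business_attraction_function_def)
  have "\<exists>p. is_arg_min (social_cost G Or De \<alpha> \<gamma> t A) (\<lambda>p. ?E (marginal_time t) (marginal_attraction A) B p) p"
    using t A B by (intro ex_cost_minimal_equilibrium)
  moreover have "?E (\<lambda>a y. t a y + \<tau> a) (\<lambda>s y z. A s y z - \<pi> s) B (f, x, q, d, h)"
    if E: "?E (marginal_time t) (marginal_attraction A) B (f, x, q, d, h)"
      and \<tau>: "\<forall>a\<in>arcs G. \<tau> a = x a * nn_deriv (t a) (x a)"
      and \<pi>: "\<forall>s\<in>De. \<pi> s = - d s * nn_deriv (\<lambda>y. A s y (h s)) (d s)"
    for f x q d h \<tau> \<pi>
  proof -
    have "?E (\<lambda>a y. t a y + \<tau> a) (\<lambda>s y z. A s y z - \<pi> s) B (f, x, q, d, h) \<longleftrightarrow>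
        ?E (marginal_time t) (marginal_attraction A) B (f, x, q, d, h)"
      using \<tau> \<pi> by (intro combined_equilibrium_cong) (simp_all add: marginal_time_def marginal_attraction_def)
    with E show ?thesis by simp
  qed
  ultimately show ?thesis
    unfolding VI by (simp add: is_arg_min_def)
qed

end
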